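(* Let $C$ and $C'$ be multi-model Cantor sets with irreducible matrices, and let $f$ be a $K$-bilipschitz map of $C$ onto a clopen subset of $C'$. Then $C$ and $C'$ have the same Hausdorff dimension $\delta$. Furthermore, there is a non-empty clopen $A$ in $C$ such that the restriction $f|_A$ is measure linear with respect to ($\delta$-dimensional) Hausdorff measure.
   Context: A subset that is both open and closed is called a clopen. A surjective map $f:X\to Y$ of metric spaces is a similarity map with scale factor $K>0$ if $d_Y(f(x_1),f(x_2))=K\,d_X(x_1,x_2)$ for all $x_1,x_2\in X$. A map $f:X\to Y$ of metric spaces is $K$-bilipschitz, for a constant $K>0$, if $\frac1K d_X(x_1,x_2)\le d_Y(f(x_1),f(x_2))\le K d_X(x_1,x_2)$ for all $x_1,x_2\in X$. Multi-model Cantor set: a metric space $C$ which is a Cantor set (compact, totally disconnected, perfect, non-empty) together with the following data (a clone structure). There is a partition of $C$ into non-empty clopens $A_1,\dots,A_n$ (the models) and another partition of $C$ into non-empty clopens $E_1,\dots,E_m$ (the level-1 clones), such that each $E_i$ is contained in some $A_j$ and each $A_j$ contains at least two of the $E_i$. For each $i$ there is given a surjective similarity map $\tau_i:E_i\to A_j$ onto some model $A_j$ (with $j$ depending on $i$), called a clone map; its scale factor is greater than $1$. The level-1 clone $E_i$ is said to be of type $j$ if $\tau_i$ maps it onto $A_j$. Matrix: for $d>0$, $M_d$ is the $n\times n$ matrix whose $(i,j)$ entry is the sum of the $d$-th powers of the inverses of the scale factors of the clone maps of those level-1 clones that are of type $i$ and are contained in the model $A_j$ (an empty sum being $0$). A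 square matrix $M$ is irreducible if all its entries are non-negative and there is some $k>0$ such that all entries of $M^k$ are positive; $C$ has irreducible matrix if $M_d$ is irreducible (this does not depend on $d$). A map $f:(X,\mu_X)\to(Y,\mu_Y)$ between metric spaces with measures is measure linear (has constant Radon-Nikodym derivative) if for some constant $c$ one has $\mu_Y(f(B))=c\,\mu_X(B)$ for all measurable subsets $B$ of $X$. Here the measures are the $\delta$-dimensional Hausdorff measures $\mathcal{H}_\delta$. *)

theory Defs
  imports "HOL-Analysis.Analysis"
begin

section \<open>Hausdorff measure and dimension\<close>

text \<open>
  The contribution of a covering set to the \<open>s\<close>-dimensional Hausdorff measure is
  its diameter to the power \<open>s\<close>. As \<open>0 powr 0 = 0\<close>, the case
  \<open>s = 0\<close> is separate: there every non-empty set contributes \<open>1\<close>.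
\<close>

definition hausdorff_gauge :: "real \<Rightarrow> 'a::metric_space set \<Rightarrow> real" where
  "hausdorff_gauge s U =
     (if U = {} then 0 else if s = 0 then 1 else diameter U powr s)"

text \<open>Boundedness is required because \<^const>\<open>diameter\<close> is unspecified on unbounded sets.\<close>

definition hausdorff_covers :: "real \<Rightarrow> 'a::metric_space set \<Rightarrow> (nat \<Rightarrow> 'a set) set" where
  "hausdorff_covers \<epsilon> X =
     {U. X \<subseteq> (\<Union>i. U i) \<and> (\<forall>i. bounded (U i) \<and> diameter (U i) \<le> \<epsilon>)}"

definition hausdorff_pre :: "real \<Rightarrow> real \<Rightarrow> 'a::metric_space set \<Rightarrow> ennreal" where
  "hausdorff_pre s \<epsilon> X =
     (INF U\<in>hausdorff_covers \<epsilon> X. \<Sum>i. ennreal (hausdorff_gauge s (U i)))"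

definition hausdorff_outer :: "real \<Rightarrow> 'a::metric_space set \<Rightarrow> ennreal" where
  "hausdorff_outer s X = (SUP \<epsilon>\<in>{0<..}. hausdorff_pre s \<epsilon> X)"

text \<open>
  The Hausdorff measure of the metric space \<open>X\<close>, on the sets that are
  measurable in the sense of Caratheodory (this includes the Borel subsets of \<open>X\<close>).
\<close>

definition hausdorff_measure :: "real \<Rightarrow> 'a::metric_space set \<Rightarrow> 'a measure" where
  "hausdorff_measure s X =
     measure_of X (lambda_system X (Pow X) (hausdorff_outer s)) (hausdorff_outer s)"

definition hausdorff_dim :: "'a::metric_space set \<Rightarrow> ennreal" where
  "hausdorff_dim X = (INF s\<in>{s. 0 \<le> s \<and> hausdorff_outer s X = 0}. ennreal s)"

lemma hausdorff_gauge_nonneg: "0 \<le> hausdorff_gauge s U"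
  by (simp add: hausdorff_gauge_def)

lemma hausdorff_pre_mono: "X \<subseteq> Y \<Longrightarrow> hausdorff_pre s \<epsilon> X \<le> hausdorff_pre s \<epsilon> Y"
  unfolding hausdorff_pre_def hausdorff_covers_def by (intro INF_superset_mono) auto

lemma hausdorff_outer_mono: "X \<subseteq> Y \<Longrightarrow> hausdorff_outer s X \<le> hausdorff_outer s Y"
  unfolding hausdorff_outer_def by (intro SUP_mono') (simp add: hausdorff_pre_mono)

lemma hausdorff_pre_empty: "0 < \<epsilon> \<Longrightarrow> hausdorff_pre s \<epsilon> {} = 0"
proof -
  assume "0 < \<epsilon>"
  then have "(\<lambda>_. {}) \<in> hausdorff_covers \<epsilon> ({} :: 'a set)"
    by (simp add: hausdorff_covers_def)
  then have "hausdorff_pre s \<epsilon> ({} :: 'a set) \<le> (\<Sum>i::nat. ennreal (hausdorff_gauge s ({} :: 'a set)))"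
    unfolding hausdorff_pre_def by (rule INF_lower)
  then show ?thesis by (simp add: hausdorff_gauge_def)
qed

lemma hausdorff_outer_empty: "hausdorff_outer s {} = 0"
  unfolding hausdorff_outer_def by (simp add: hausdorff_pre_empty)

lemma hausdorff_pre_countably_subadditive:
  "hausdorff_pre s \<epsilon> (\<Union>i::nat. A i) \<le> (\<Sum>i. hausdorff_pre s \<epsilon> (A i))"
proof (rule ennreal_le_epsilon)
  fix e :: real
  assume e: "0 < e" and fin: "(\<Sum>i. hausdorff_pre s \<epsilon> (A i)) < top"
  let ?w = "\<lambda>U. ennreal (hausdorff_gauge s U)"
  have "\<exists>U\<in>hausdorff_covers \<epsilon> (A n). (\<Sum>i. ?w (U i)) \<le> hausdorff_pre s \<epsilon> (A n) + e * (1/2)^Suc n" for n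
  proof -
    have "hausdorff_pre s \<epsilon> (A n) \<noteq> top"
      using fin ennreal_suminf_lessD[OF fin] by (auto simp: less_top)
    then have "hausdorff_pre s \<epsilon> (A n) < hausdorff_pre s \<epsilon> (A n) + ennreal (e * (1/2)^Suc n)"
      using e by (auto simp: less_top ennreal_add_left_cancel_less[where b=0, simplified])
    then show ?thesis
      using INF_less_iff[of "\<lambda>U. \<Sum>i. ?w (U i)" "hausdorff_covers \<epsilon> (A n)"]
      by (auto simp: hausdorff_pre_def intro: less_imp_le)
  qed
  then obtain V where V: "\<And>n. V n \<in> hausdorff_covers \<epsilon> (A n)"
    and le: "\<And>n. (\<Sum>i. ?w (V n i)) \<le> hausdorff_pre s \<epsilon> (A n) + e * (1/2)^Suc n"
    by metis
  define U where "U = (\<lambda>k. case prod_decode k of (n, i) \<Rightarrow> V n i)"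
  have U: "U \<in> hausdorff_covers \<epsilon> (\<Union>i. A i)"
  proof -
    have "x \<in> (\<Union>k. U k)" if x: "x \<in> A n" for x n
    proof -
      obtain i where "x \<in> V n i" using V[of n] x by (auto simp: hausdorff_covers_def)
      then have "x \<in> U (prod_encode (n, i))" by (simp add: U_def)
      then show ?thesis by blast
    qed
    moreover have "bounded (U k) \<and> diameter (U k) \<le> \<epsilon>" for k
      using V by (auto simp: U_def hausdorff_covers_def split: prod.split)
    ultimately show ?thesis by (auto simp: hausdorff_covers_def)
  qed
  have "hausdorff_pre s \<epsilon> (\<Union>i. A i) \<le> (\<Sum>k. ?w (U k))"
    unfolding hausdorff_pre_def using U by (rule INF_lower)
  also have "\<dots> = (\<Sum>n. \<Sum>i. ?w (V n i))"
    unfolding suminf_ennreal_2dimen[OF refl, of "\<lambda>(n, i). ?w (V n i)", symmetric, simplified]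
    by (simp add: U_def comp_def case_prod_beta)
  also have "\<dots> \<le> (\<Sum>n. hausdorff_pre s \<epsilon> (A n) + ennreal (e * (1/2)^Suc n))"
    by (intro suminf_le le) auto
  also have "\<dots> = (\<Sum>n. hausdorff_pre s \<epsilon> (A n)) + (\<Sum>n. ennreal (e * (1/2)^Suc n))"
    by (rule suminf_add[symmetric]) auto
  also have "(\<Sum>n. ennreal (e * (1/2)^Suc n)) = ennreal e"
    using e sums_mult[OF power_half_series, of e] by (intro suminf_ennreal_eq) auto
  finally show "hausdorff_pre s \<epsilon> (\<Union>i. A i) \<le> (\<Sum>i. hausdorff_pre s \<epsilon> (A i)) + ennreal e" .
qed

lemma outer_measure_space_hausdorff: "outer_measure_space (Pow X) (hausdorff_outer s)"
  unfolding outer_measure_space_def positive_def increasing_def countably_subadditive_def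
proof (intro conjI ballI allI impI)
  fix A :: "nat \<Rightarrow> 'a set"
  show "hausdorff_outer s (\<Union>i. A i) \<le> (\<Sum>i. hausdorff_outer s (A i))"
    unfolding hausdorff_outer_def[of s "\<Union>i. A i"]
  proof (rule SUP_least)
    fix \<epsilon> :: real assume "\<epsilon> \<in> {0<..}"
    then have "hausdorff_pre s \<epsilon> (A i) \<le> hausdorff_outer s (A i)" for i
      unfolding hausdorff_outer_def by (rule SUP_upper)
    then have "(\<Sum>i. hausdorff_pre s \<epsilon> (A i)) \<le> (\<Sum>i. hausdorff_outer s (A i))"
      by (intro suminf_le) auto
    with hausdorff_pre_countably_subadditive
    show "hausdorff_pre s \<epsilon> (\<Union>i. A i) \<le> (\<Sum>i. hausdorff_outer s (A i))"
      by (rule order_trans)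
  qed
qed (auto simp: hausdorff_outer_empty hausdorff_outer_mono)

lemma measure_space_hausdorff:
  "measure_space X (lambda_system X (Pow X) (hausdorff_outer s)) (hausdorff_outer s)"
  by (rule sigma_algebra.caratheodory_lemma[OF sigma_algebra_Pow outer_measure_space_hausdorff])

lemma space_hausdorff_measure: "space (hausdorff_measure s X) = X"
  using measure_space_hausdorff[of X s] unfolding hausdorff_measure_def
  by (simp add: space_measure_of_conv)

lemma sets_hausdorff_measure:
  "sets (hausdorff_measure s X) = lambda_system X (Pow X) (hausdorff_outer s)"
  using measure_space_hausdorff[of X s] unfolding hausdorff_measure_def measure_space_def
  by (auto simp: sets_measure_of_conv lambda_system_def sigma_algebra.sigma_sets_eq)

lemma emeasure_hausdorff_measure:
  assumes "B \<in> sets (hausdorff_measure s X)"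
  shows "emeasure (hausdorff_measure s X) B = hausdorff_outer s B"
  using assms measure_space_hausdorff[of X s]
  unfolding sets_hausdorff_measure unfolding hausdorff_measure_def
  by (intro emeasure_measure_of_sigma) (auto simp: measure_space_def)

section \<open>Maps\<close>

definition similarity_map ::
    "real \<Rightarrow> 'a::metric_space set \<Rightarrow> 'b::metric_space set \<Rightarrow> ('a \<Rightarrow> 'b) \<Rightarrow> bool" where
  "similarity_map K X Y f \<longleftrightarrow>
     0 < K \<and> f ` X = Y \<and> (\<forall>x1\<in>X. \<forall>x2\<in>X. dist (f x1) (f x2) = K * dist x1 x2)"

definition bilipschitz_on ::
    "real \<Rightarrow> 'a::metric_space set \<Rightarrow> ('a \<Rightarrow> 'b::metric_space) \<Rightarrow> bool" where
  "bilipschitz_on K X f \<longleftrightarrow>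
     0 < K \<and> (\<forall>x1\<in>X. \<forall>x2\<in>X. 1 / K * dist x1 x2 \<le> dist (f x1) (f x2)
                             \<and> dist (f x1) (f x2) \<le> K * dist x1 x2)"

definition measure_linear :: "'a measure \<Rightarrow> 'b measure \<Rightarrow> ('a \<Rightarrow> 'b) \<Rightarrow> bool" where
  "measure_linear M N f \<longleftrightarrow>
     (\<exists>c::real. 0 \<le> c \<and>
        (\<forall>B\<in>sets M. f ` B \<in> sets N \<and> emeasure N (f ` B) = ennreal c * emeasure M B))"

section \<open>Multi-model Cantor sets\<close>

definition clopen_in :: "'a::topological_space set \<Rightarrow> 'a set \<Rightarrow> bool" where
  "clopen_in X A \<longleftrightarrow> openin (top_of_set X) A \<and> closedin (top_of_set X) A"

definition cantor_set :: "'a::topological_space set \<Rightarrow> bool" where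
  "cantor_set C \<longleftrightarrow>
     compact C \<and>
     (\<forall>S. S \<subseteq> C \<and> connected S \<longrightarrow> (\<exists>x. S \<subseteq> {x})) \<and>
     (\<forall>x\<in>C. x islimpt C) \<and>
     C \<noteq> {}"

definition clopen_partition :: "'a::topological_space set \<Rightarrow> ('i \<Rightarrow> 'a set) \<Rightarrow> bool" where
  "clopen_partition C A \<longleftrightarrow>
     (\<forall>i. A i \<noteq> {} \<and> clopen_in C (A i)) \<and> disjoint_family A \<and> (\<Union>i. A i) = C"

text \<open>
  \<open>A\<close> are the models, \<open>E\<close> the level-1 clones, \<open>\<tau>\<close> the clone maps
  and \<open>r\<close> their scale factors. Models and level-1 clones are indexed by finite types.
  The factors \<open>r\<close> carry no extra data: each \<open>E i\<close>, being non-empty and open in a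
  perfect set, has more than one point, so \<open>r i\<close> is determined by \<open>\<tau> i\<close>.
\<close>

locale multi_model_cantor_set =
  fixes C :: "'a::metric_space set"
    and A :: "'n::finite \<Rightarrow> 'a set"
    and E :: "'m::finite \<Rightarrow> 'a set"
    and \<tau> :: "'m \<Rightarrow> 'a \<Rightarrow> 'a"
    and r :: "'m \<Rightarrow> real"
  assumes cantor: "cantor_set C"
    and models: "clopen_partition C A"
    and clones: "clopen_partition C E"
    and clone_in_model: "\<exists>j. E i \<subseteq> A j"
    and two_clones: "2 \<le> card {i. E i \<subseteq> A j}"
    and clone_map: "\<exists>j. similarity_map (r i) (E i) (A j) (\<tau> i)"
    and scale_gt_1: "1 < r i"

definition clone_matrix ::
    "('n::finite \<Rightarrow> 'a set) \<Rightarrow> ('m::finite \<Rightarrow> 'a set) \<Rightarrow> ('m \<Rightarrow> 'a \<Rightarrow> 'a) \<Rightarrow> ('m \<Rightarrow> real) \<Rightarrow>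
     real \<Rightarrow> real ^ 'n ^ 'n" where
  "clone_matrix A E \<tau> r d =
     (\<chi> i j. \<Sum>k | \<tau> k ` E k = A i \<and> E k \<subseteq> A j. (1 / r k) powr d)"

definition irreducible_matrix :: "real ^ 'n ^ 'n \<Rightarrow> bool" where
  "irreducible_matrix M \<longleftrightarrow>
     (\<forall>i j. 0 \<le> M $ i $ j) \<and>
     (\<exists>k>0. \<forall>i j. 0 < (((**) M ^^ k) (mat 1)) $ i $ j)"

text \<open>
  Which entries of the matrix and of its powers vanish does not depend on \<open>d\<close>, so
  it is immaterial whether \<open>d\<close> is quantified existentially or universally.
\<close>

definition has_irreducible_matrix ::
    "('n::finite \<Rightarrow> 'a set) \<Rightarrow> ('m::finite \<Rightarrow> 'a set) \<Rightarrow> ('m \<Rightarrow> 'a \<Rightarrow> 'a) \<Rightarrow> ('m \<Rightarrow> real) \<Rightarrow> bool" where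
  "has_irreducible_matrix A E \<tau> r \<longleftrightarrow>
     (\<exists>d>0. irreducible_matrix (clone_matrix A E \<tau> r d))"

end

theory Submission
  imports Defs
begin

text \<open>
  The clone maps glue to one expanding map of \<open>C\<close>, whose \<open>n\<close>-th iterate is a similarity on every
  level-\<open>n\<close> clone. Let \<open>\<delta>\<close> be the dimension of \<open>C\<close>. Covers by small sets can be zoomed to covers by
  large ones, so \<open>H\<^sub>d(C) = 0\<close> (for \<open>d > 0\<close>) exactly if the \<open>d\<close>-weighted number of level-\<open>n\<close> clones drops
  below \<open>1\<close> for some \<open>n\<close>. This is an open condition on \<open>d\<close>, hence fails at \<open>\<delta>\<close>; irreducibility
  bounds the weighted numbers at \<open>\<delta>\<close>, and so \<open>0 < H\<^sub>\<delta>(C) < \<infinity>\<close>.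

  Zooming in \<open>C'\<close> at the image of a clone turns it into a subset of \<open>C'\<close> whose distance from its
  complement is bounded below by a constant. There are only finitely many such subsets, and so the
  density \<open>H\<^sub>\<delta>(f(c)) / H\<^sub>\<delta>(c)\<close> of a clone \<open>c\<close> changes by one of finitely many factors when passing
  to a child. Near the supremum of the densities this factor cannot exceed \<open>1\<close>, hence by
  additivity it equals \<open>1\<close>, for all descendants: the density is constant on some clone.
\<close>

section \<open>Hausdorff outer measure\<close>

text \<open>No eigenvalue theory enters: the weighted counts are column sums of powers of the clone
  matrix, and their sub- and supermultiplicativity do the work of a spectral radius. The bilipschitz
  bound keeps all densities in a bounded range, so they have a supremum, but nothing makes it
  attained; the finite set of factors compensates, because it leaves a definite gap above 1. Once
  the density is constant on all subclones of one clone, a further obstacle remains: the Hausdorff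
  measure lives on all Caratheodory measurable sets, whereas a generator argument reaches only the
  sigma-algebra generated by clones. Hence the scaling law is extended to the outer measure of
  arbitrary subsets, through hulls built from closed sets, and Caratheodory's criterion is then
  transported along \<open>f\<close>.\<close>

lemma diameter_le_if_dist_le:
  fixes S :: "'a::metric_space set"
  assumes "0 \<le> d" "\<And>x y. x \<in> S \<Longrightarrow> y \<in> S \<Longrightarrow> dist x y \<le> d"
  shows "diameter S \<le> d"
  using assms by (auto simp: diameter_def intro!: cSUP_least)

lemma hausdorff_pre_antimono: "\<epsilon> \<le> \<epsilon>' \<Longrightarrow> hausdorff_pre s \<epsilon>' X \<le> hausdorff_pre s \<epsilon> X"
  unfolding hausdorff_pre_def hausdorff_covers_def by (intro INF_superset_mono) (auto intro: order_trans)

lemma hausdorff_pre_le_outer: "0 < \<epsilon> \<Longrightarrow> hausdorff_pre s \<epsilon> X \<le> hausdorff_outer s X"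
  unfolding hausdorff_outer_def by (rule SUP_upper) simp

section \<open>Lipschitz maps and similarities\<close>

lemma lipschitz_image_diameter:
  fixes g :: "'a::metric_space \<Rightarrow> 'b::metric_space"
  assumes L: "0 < L" "\<And>x y. x \<in> X \<Longrightarrow> y \<in> X \<Longrightarrow> dist (g x) (g y) \<le> L * dist x y"
    and U: "bounded U"
  shows "bounded (g ` (X \<inter> U))" "diameter (g ` (X \<inter> U)) \<le> L * diameter U"
proof -
  have *: "dist (g x) (g y) \<le> L * diameter U" if "x \<in> X \<inter> U" "y \<in> X \<inter> U" for x y
  proof -
    have "dist x y \<le> diameter U" using that diameter_bounded_bound[OF U] by auto
    then show ?thesis using L(2)[of x y] that L(1) by (meson IntD1 mult_left_mono less_imp_le order_trans)
  qed
  show "bounded (g ` (X \<inter> U))"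
    unfolding bounded_two_points using * by (intro exI[of _ "L * diameter U"]) auto
  show "diameter (g ` (X \<inter> U)) \<le> L * diameter U"
    using * L(1) diameter_ge_0[OF U] by (intro diameter_le_if_dist_le) auto
qed

lemma lipschitz_image_gauge:
  fixes g :: "'a::metric_space \<Rightarrow> 'b::metric_space"
  assumes L: "0 < L" "\<And>x y. x \<in> X \<Longrightarrow> y \<in> X \<Longrightarrow> dist (g x) (g y) \<le> L * dist x y"
    and U: "bounded U" and s: "0 \<le> s"
  shows "hausdorff_gauge s (g ` (X \<inter> U)) \<le> L powr s * hausdorff_gauge s U"
proof -
  note d = lipschitz_image_diameter[OF L U]
  have "diameter (g ` (X \<inter> U)) powr s \<le> (L * diameter U) powr s"
    using d diameter_ge_0[OF d(1)] s by (intro powr_mono2) auto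
  then show ?thesis
    using L(1) diameter_ge_0[OF U] by (auto simp: hausdorff_gauge_def powr_mult)
qed

lemma le_ennreal_mult_INF:
  assumes "0 < c" "\<And>i. i \<in> I \<Longrightarrow> a \<le> ennreal c * f i"
  shows "a \<le> ennreal c * (INF i\<in>I. f i)"
proof -
  have "ennreal (1 / c) * a \<le> f i" if "i \<in> I" for i
  proof -
    have "ennreal (1 / c) * a \<le> ennreal (1 / c) * (ennreal c * f i)"
      using assms(2)[OF that] by (rule mult_left_mono) simp
    also have "\<dots> = f i"
      using assms(1) by (simp add: mult.assoc[symmetric] ennreal_mult[symmetric])
    finally show ?thesis .
  qed
  then have "ennreal (1 / c) * a \<le> (INF i\<in>I. f i)" by (rule INF_greatest)
  then have "ennreal c * (ennreal (1 / c) * a) \<le> ennreal c * (INF i\<in>I. f i)"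
    by (rule mult_left_mono) simp
  then show ?thesis
    using assms(1) by (simp add: mult.assoc[symmetric] ennreal_mult[symmetric])
qed

lemma lipschitz_image_pre:
  fixes g :: "'a::metric_space \<Rightarrow> 'b::metric_space"
  assumes L: "0 < L" "\<And>x y. x \<in> X \<Longrightarrow> y \<in> X \<Longrightarrow> dist (g x) (g y) \<le> L * dist x y"
    and s: "0 \<le> s"
  shows "hausdorff_pre s (L * \<epsilon>) (g ` X) \<le> ennreal (L powr s) * hausdorff_pre s \<epsilon> X"
  unfolding hausdorff_pre_def[of s \<epsilon>]
proof (rule le_ennreal_mult_INF)
  show "0 < L powr s" using L(1) by simp
  fix U assume U: "U \<in> hausdorff_covers \<epsilon> X"
  \<comment> \<open>Members of a cover may leave \<open>X\<close>, where \<open>g\<close> is not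
    controlled, so they are cut down to \<open>X\<close> before being mapped.\<close>
  let ?V = "\<lambda>i. g ` (X \<inter> U i)"
  have V: "?V \<in> hausdorff_covers (L * \<epsilon>) (g ` X)"
  proof -
    have "diameter (?V i) \<le> L * \<epsilon>" for i
    proof -
      have "diameter (?V i) \<le> L * diameter (U i)"
        using lipschitz_image_diameter(2)[OF L] U by (auto simp: hausdorff_covers_def)
      also have "\<dots> \<le> L * \<epsilon>" using U L(1) by (auto simp: hausdorff_covers_def)
      finally show ?thesis .
    qed
    moreover have "bounded (?V i)" for i
      using U by (intro lipschitz_image_diameter(1)[OF L]) (auto simp: hausdorff_covers_def)
    moreover have "g ` X \<subseteq> (\<Union>i. ?V i)"
      using U by (fastforce simp: hausdorff_covers_def)
    ultimately show ?thesis by (simp add: hausdorff_covers_def)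
  qed
  have "hausdorff_pre s (L * \<epsilon>) (g ` X) \<le> (\<Sum>i. ennreal (hausdorff_gauge s (?V i)))"
    unfolding hausdorff_pre_def using V by (rule INF_lower)
  also have "\<dots> \<le> (\<Sum>i. ennreal (L powr s) * ennreal (hausdorff_gauge s (U i)))"
  proof (intro suminf_le)
    fix i
    have "hausdorff_gauge s (?V i) \<le> L powr s * hausdorff_gauge s (U i)"
      using U by (intro lipschitz_image_gauge L s) (auto simp: hausdorff_covers_def)
    then show "ennreal (hausdorff_gauge s (?V i)) \<le> ennreal (L powr s) * ennreal (hausdorff_gauge s (U i))"
      by (simp add: ennreal_mult[symmetric] hausdorff_gauge_nonneg ennreal_leI)
  qed auto
  also have "\<dots> = ennreal (L powr s) * (\<Sum>i. ennreal (hausdorff_gauge s (U i)))"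
    by simp
  finally show "hausdorff_pre s (L * \<epsilon>) (g ` X) \<le> ennreal (L powr s) * (\<Sum>i. ennreal (hausdorff_gauge s (U i)))" .
qed

lemma lipschitz_image_outer:
  fixes g :: "'a::metric_space \<Rightarrow> 'b::metric_space"
  assumes L: "0 < L" "\<And>x y. x \<in> X \<Longrightarrow> y \<in> X \<Longrightarrow> dist (g x) (g y) \<le> L * dist x y"
    and s: "0 \<le> s"
  shows "hausdorff_outer s (g ` X) \<le> ennreal (L powr s) * hausdorff_outer s X"
  unfolding hausdorff_outer_def[of s "g ` X"]
proof (rule SUP_least)
  fix \<epsilon> :: real assume e: "\<epsilon> \<in> {0<..}"
  have "hausdorff_pre s \<epsilon> (g ` X) = hausdorff_pre s (L * (\<epsilon> / L)) (g ` X)" using L(1) by simp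
  also have "\<dots> \<le> ennreal (L powr s) * hausdorff_pre s (\<epsilon> / L) X"
    using L s by (rule lipschitz_image_pre)
  also have "\<dots> \<le> ennreal (L powr s) * hausdorff_outer s X"
    using e L(1) by (intro mult_left_mono hausdorff_pre_le_outer) auto
  finally show "hausdorff_pre s \<epsilon> (g ` X) \<le> ennreal (L powr s) * hausdorff_outer s X" .
qed

text \<open>Both inequalities are Lipschitz estimates, the second one for the inverse map with
  constant \<open>1 / L\<close>.\<close>

lemma similarity_image_outer:
  fixes g :: "'a::metric_space \<Rightarrow> 'b::metric_space"
  assumes L: "0 < L" "\<And>x y. x \<in> X \<Longrightarrow> y \<in> X \<Longrightarrow> dist (g x) (g y) = L * dist x y"
    and s: "0 \<le> s"
  shows "hausdorff_outer s (g ` X) = ennreal (L powr s) * hausdorff_outer s X"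
proof (rule antisym)
  show "hausdorff_outer s (g ` X) \<le> ennreal (L powr s) * hausdorff_outer s X"
    using L s by (intro lipschitz_image_outer) auto
  have inj: "inj_on g X" using L by (auto simp: inj_on_def) (metis dist_eq_0_iff mult_eq_0_iff less_irrefl)
  let ?h = "inv_into X g"
  have X: "X = ?h ` (g ` X)" using inj by simp
  have "hausdorff_outer s (?h ` (g ` X)) \<le> ennreal ((1 / L) powr s) * hausdorff_outer s (g ` X)"
    using L s inj by (intro lipschitz_image_outer) auto
  then have "ennreal (L powr s) * hausdorff_outer s X
      \<le> ennreal (L powr s) * (ennreal ((1 / L) powr s) * hausdorff_outer s (g ` X))"
    unfolding X[symmetric] by (rule mult_left_mono) simp
  also have "\<dots> = hausdorff_outer s (g ` X)"
    using L(1) by (simp add: mult.assoc[symmetric] ennreal_mult[symmetric] powr_mult[symmetric])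
  finally show "ennreal (L powr s) * hausdorff_outer s X \<le> hausdorff_outer s (g ` X)" .
qed

section \<open>Separated sets, closed hulls and compact null sets\<close>

lemma hausdorff_outer_Un_le: "hausdorff_outer s (S \<union> T) \<le> hausdorff_outer s S + hausdorff_outer s T"
proof -
  let ?T = "T - S"
  have "disjoint_family (binaryset S ?T)" by (auto simp: disjoint_family_on_def binaryset_def)
  then have "hausdorff_outer s (\<Union>i. binaryset S ?T i) \<le> (\<Sum>i. hausdorff_outer s (binaryset S ?T i))"
    using outer_measure_space_hausdorff[of UNIV s]
    unfolding outer_measure_space_def countably_subadditive_def by auto
  then have "hausdorff_outer s (S \<union> T) \<le> hausdorff_outer s S + hausdorff_outer s ?T"
    by (simp add: UN_binaryset_eq suminf_binaryset_eq hausdorff_outer_empty)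
  also have "\<dots> \<le> hausdorff_outer s S + hausdorff_outer s T"
    by (intro add_left_mono hausdorff_outer_mono) auto
  finally show ?thesis .
qed

text \<open>A set of diameter below \<open>\<eta>\<close> cannot meet both \<open>S\<close> and
  \<open>T\<close>, so a fine cover of the union splits into covers of the two parts. This metric
  outer measure property is what makes clones and their images measurable.\<close>

lemma hausdorff_outer_separated:
  fixes S T :: "'a::metric_space set"
  assumes \<eta>: "0 < \<eta>" "\<And>x y. x \<in> S \<Longrightarrow> y \<in> T \<Longrightarrow> \<eta> \<le> dist x y" and s: "0 \<le> s"
  shows "hausdorff_outer s (S \<union> T) = hausdorff_outer s S + hausdorff_outer s T"
proof (rule antisym)
  show "hausdorff_outer s (S \<union> T) \<le> hausdorff_outer s S + hausdorff_outer s T"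
    by (rule hausdorff_outer_Un_le)
  have pre: "hausdorff_pre s \<epsilon> S + hausdorff_pre s \<epsilon> T \<le> hausdorff_pre s \<epsilon> (S \<union> T)"
    if e: "0 < \<epsilon>" "\<epsilon> < \<eta>" for \<epsilon>
    unfolding hausdorff_pre_def[of s \<epsilon> "S \<union> T"]
  proof (rule INF_greatest)
    fix U assume U: "U \<in> hausdorff_covers \<epsilon> (S \<union> T)"
    define V where "V i = (if U i \<inter> S = {} then {} else U i)" for i
    define W where "W i = (if U i \<inter> S = {} then U i else {})" for i
    have no: "U i \<inter> S = {} \<or> U i \<inter> T = {}" for i
    proof (rule ccontr)
      assume "\<not> ?thesis"
      then obtain x y where xy: "x \<in> U i" "x \<in> S" "y \<in> U i" "y \<in> T" by blast
      then have "dist x y \<le> \<epsilon>"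
        using U diameter_bounded_bound[of "U i" x y] by (auto simp: hausdorff_covers_def intro: order_trans)
      then show False using \<eta>(2)[OF xy(2,4)] e by simp
    qed
    have V: "V \<in> hausdorff_covers \<epsilon> S"
      using U e by (auto simp: hausdorff_covers_def V_def subset_iff) (metis IntI UN_iff empty_iff)
    have W: "W \<in> hausdorff_covers \<epsilon> T"
      using U e no by (auto simp: hausdorff_covers_def W_def subset_iff) (metis IntI UN_iff empty_iff)
    have "hausdorff_pre s \<epsilon> S + hausdorff_pre s \<epsilon> T
        \<le> (\<Sum>i. ennreal (hausdorff_gauge s (V i))) + (\<Sum>i. ennreal (hausdorff_gauge s (W i)))"
      unfolding hausdorff_pre_def using V W by (intro add_mono INF_lower)
    also have "\<dots> = (\<Sum>i. ennreal (hausdorff_gauge s (V i)) + ennreal (hausdorff_gauge s (W i)))"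
      by (rule suminf_add) auto
    also have "\<dots> = (\<Sum>i. ennreal (hausdorff_gauge s (U i)))"
      by (rule arg_cong[where f = suminf]) (auto simp: V_def W_def hausdorff_gauge_def)
    finally show "hausdorff_pre s \<epsilon> S + hausdorff_pre s \<epsilon> T \<le> (\<Sum>i. ennreal (hausdorff_gauge s (U i)))" .
  qed
  \<comment> \<open>The two meshes are kept independent, so that the suprema defining the two outer
    measures can be taken one after the other.\<close>
  have *: "hausdorff_pre s a S + hausdorff_pre s b T \<le> hausdorff_outer s (S \<union> T)" if "0 < a" "0 < b" for a b
  proof -
    define e where "e = min (\<eta> / 2) (min a b)"
    have e: "0 < e" "e < \<eta>" "e \<le> a" "e \<le> b" using that \<eta>(1) by (auto simp: e_def)
    have "hausdorff_pre s a S + hausdorff_pre s b T \<le> hausdorff_pre s e S + hausdorff_pre s e T"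
      using e by (intro add_mono hausdorff_pre_antimono)
    also have "\<dots> \<le> hausdorff_pre s e (S \<union> T)" using e by (intro pre)
    also have "\<dots> \<le> hausdorff_outer s (S \<union> T)" using e by (intro hausdorff_pre_le_outer)
    finally show ?thesis .
  qed
  have "hausdorff_outer s S + hausdorff_pre s b T \<le> hausdorff_outer s (S \<union> T)" if "0 < b" for b
    unfolding hausdorff_outer_def[of s S]
    using * that by (subst ennreal_SUP_add_left[symmetric]) (auto intro!: SUP_least)
  then have "(SUP b\<in>{0<..}. hausdorff_outer s S + hausdorff_pre s b T) \<le> hausdorff_outer s (S \<union> T)"
    by (intro SUP_least) auto
  then show "hausdorff_outer s S + hausdorff_outer s T \<le> hausdorff_outer s (S \<union> T)"
    unfolding hausdorff_outer_def[of s T] by (subst ennreal_SUP_add_right) auto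
qed

text \<open>Closing the members of a cover changes no diameter, so intersecting closed, nearly
  optimal covers of finer and finer mesh loses no measure. The hull is built from closed sets by
  countable operations; this is how a law known on a sigma-algebra reaches arbitrary sets.\<close>

lemma hausdorff_outer_closed_hull:
  fixes S :: "'a::metric_space set"
  assumes fin: "hausdorff_outer s S < top" and s: "0 \<le> s"
  obtains F :: "nat \<Rightarrow> nat \<Rightarrow> 'a set" where "\<And>n i. closed (F n i)"
    "S \<subseteq> (\<Inter>n. \<Union>i. F n i)" "hausdorff_outer s (\<Inter>n. \<Union>i. F n i) \<le> hausdorff_outer s S"
proof -
  \<comment> \<open>One null sequence serves both as mesh and as permitted error.\<close>
  let ?e = "\<lambda>n. 1 / real (Suc n)"
  have "\<exists>U\<in>hausdorff_covers (?e n) S.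
      (\<Sum>i. ennreal (hausdorff_gauge s (U i))) \<le> hausdorff_outer s S + ?e n" for n
  proof -
    have "hausdorff_pre s (?e n) S \<le> hausdorff_outer s S" by (intro hausdorff_pre_le_outer) auto
    also have "\<dots> < hausdorff_outer s S + ennreal (?e n)"
      using fin by (auto simp: less_top ennreal_add_left_cancel_less[where b=0, simplified])
    finally show ?thesis
      using INF_less_iff[of "\<lambda>U. \<Sum>i. ennreal (hausdorff_gauge s (U i))" "hausdorff_covers (?e n) S"]
      by (auto simp: hausdorff_pre_def intro: less_imp_le)
  qed
  then obtain U where U: "\<And>n. U n \<in> hausdorff_covers (?e n) S"
    and le: "\<And>n. (\<Sum>i. ennreal (hausdorff_gauge s (U n i))) \<le> hausdorff_outer s S + ?e n"
    by metis
  define F where "F n i = closure (U n i)" for n i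
  define G where "G = (\<Inter>n. \<Union>i. F n i)"
  have bd: "bounded (U n i)" for n i using U[of n] by (auto simp: hausdorff_covers_def)
  have dF: "diameter (F n i) = diameter (U n i)" for n i
    unfolding F_def using bd by (rule diameter_closure)
  have gF: "hausdorff_gauge s (F n i) = hausdorff_gauge s (U n i)" for n i
    using dF[of n i] by (simp add: hausdorff_gauge_def F_def closure_eq_empty)
  have pre: "hausdorff_pre s (?e n) G \<le> hausdorff_outer s S + ?e n" for n
  proof -
    have "F n \<in> hausdorff_covers (?e n) G"
      using U[of n] bd dF by (auto simp: hausdorff_covers_def G_def F_def bounded_closure)
    then have "hausdorff_pre s (?e n) G \<le> (\<Sum>i. ennreal (hausdorff_gauge s (F n i)))"
      unfolding hausdorff_pre_def by (rule INF_lower)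
    then show ?thesis using le[of n] by (simp add: gF)
  qed
  have "hausdorff_outer s G \<le> hausdorff_outer s S"
    unfolding hausdorff_outer_def[of s G]
  proof (rule SUP_least, rule ennreal_le_epsilon)
    fix \<epsilon> e :: real assume e: "\<epsilon> \<in> {0<..}" "0 < e"
    obtain n where n: "?e n < min \<epsilon> e" using e nat_approx_posE[of "min \<epsilon> e"] by auto
    have "hausdorff_pre s \<epsilon> G \<le> hausdorff_pre s (?e n) G" using n by (intro hausdorff_pre_antimono) auto
    also have "\<dots> \<le> hausdorff_outer s S + ?e n" by (rule pre)
    also have "\<dots> \<le> hausdorff_outer s S + ennreal e" using n by (intro add_left_mono ennreal_leI) auto
    finally show "hausdorff_pre s \<epsilon> G \<le> hausdorff_outer s S + ennreal e" .
  qed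
  moreover have "S \<subseteq> G"
  proof
    fix x assume "x \<in> S"
    then have "\<exists>i. x \<in> U n i" for n using U[of n] by (auto simp: hausdorff_covers_def)
    then have "\<exists>i. x \<in> F n i" for n unfolding F_def by (meson closure_subset subsetD)
    then show "x \<in> G" unfolding G_def by blast
  qed
  ultimately show thesis using that[of F] by (simp add: F_def G_def)
qed

text \<open>Excludes 0 as a null exponent, so that the zooming argument, which needs a positive
  exponent, applies to every null exponent.\<close>

lemma hausdorff_outer_0_ge_1:
  assumes "X \<noteq> {}"
  shows "1 \<le> hausdorff_outer 0 X"
proof -
  have "1 \<le> hausdorff_pre 0 1 X"
    unfolding hausdorff_pre_def
  proof (rule INF_greatest)
    fix U assume "U \<in> hausdorff_covers 1 X"
    then obtain i where i: "U i \<noteq> {}" using assms by (fastforce simp: hausdorff_covers_def)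
    have "(\<Sum>j\<in>{i}. ennreal (hausdorff_gauge 0 (U j))) \<le> (\<Sum>i. ennreal (hausdorff_gauge 0 (U i)))"
      by (rule sum_le_suminf) auto
    then show "1 \<le> (\<Sum>i. ennreal (hausdorff_gauge 0 (U i)))" using i by (simp add: hausdorff_gauge_def)
  qed
  also have "\<dots> \<le> hausdorff_outer 0 X" by (rule hausdorff_pre_le_outer) simp
  finally show ?thesis .
qed

text \<open>Extracting a finite subcover requires open sets, so each member of a countable cover is
  fattened a little. The bounds \<open>t i\<close> strictly exceed the diameters and are therefore
  positive even for one-point members, so finitely many expansions can bring each of them up to a
  given size.\<close>

lemma hausdorff_null_finite_open_cover:
  fixes X :: "'a::metric_space set"
  assumes X: "compact X" and null: "hausdorff_outer s X = 0" and s: "0 < s" and c: "0 < c"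
  obtains I :: "nat set" and V :: "nat \<Rightarrow> 'a set" and t :: "nat \<Rightarrow> real" where
    "finite I" "X \<subseteq> (\<Union>i\<in>I. V i)" "\<And>i. 0 < t i"
    "\<And>i x y. x \<in> V i \<Longrightarrow> y \<in> V i \<Longrightarrow> dist x y \<le> t i" "(\<Sum>i\<in>I. t i powr s) \<le> c"
proof -
  have "hausdorff_pre s 1 X \<le> 0" using hausdorff_pre_le_outer[of 1 s X] null by simp
  also have "0 < ennreal (c / 2)" using c by simp
  finally obtain U where U: "U \<in> hausdorff_covers 1 X"
    and lt: "(\<Sum>i. ennreal (hausdorff_gauge s (U i))) < ennreal (c / 2)"
    unfolding hausdorff_pre_def INF_less_iff by blast
  have bd: "bounded (U i)" for i using U by (auto simp: hausdorff_covers_def)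
  let ?d = "\<lambda>i. diameter (U i)"
  \<comment> \<open>Half of the budget \<open>c\<close> pays for the cover, the other half is spread
    geometrically over the fattening.\<close>
  let ?a = "\<lambda>i. c / 2 * (1/2) ^ Suc i"
  have "\<exists>t>?d i. t powr s \<le> ?d i powr s + ?a i" for i
  proof -
    \<comment> \<open>Right continuity is delicate only at diameter 0, where it rests on
      \<open>0 < s\<close>.\<close>
    have "((\<lambda>t. t powr s) \<longlongrightarrow> ?d i powr s) (at_right (?d i))"
    proof (rule tendsto_powr')
      show "((\<lambda>t. t) \<longlongrightarrow> ?d i) (at_right (?d i))" by (rule tendsto_ident_at)
      show "((\<lambda>t. s) \<longlongrightarrow> s) (at_right (?d i))" by (rule tendsto_const)
      show "?d i \<noteq> 0 \<or> 0 < s \<and> (\<forall>\<^sub>F x in at_right (?d i). 0 \<le> x)"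
      proof -
        have "\<forall>\<^sub>F x in at_right (?d i). 0 \<le> x"
          using eventually_at_right_less[of "?d i"] 
          by eventually_elim (use diameter_ge_0[OF bd[of i]] in linarith)
        then show ?thesis using s by blast
      qed
    qed
    moreover have "?d i powr s < ?d i powr s + ?a i" using c by simp
    ultimately have "\<forall>\<^sub>F t in at_right (?d i). t powr s < ?d i powr s + ?a i"
      by (rule order_tendstoD(2))
    then have "\<forall>\<^sub>F t in at_right (?d i). ?d i < t \<and> t powr s \<le> ?d i powr s + ?a i"
      using eventually_at_right_less[of "?d i"] by eventually_elim simp
    then show ?thesis
      using eventually_happens'[OF trivial_limit_at_right_real] by blast
  qed
  then obtain t where t: "\<And>i. ?d i < t i" "\<And>i. t i powr s \<le> ?d i powr s + ?a i" by metis
  \<comment> \<open>Each point of the fattening is within half the slack of \<open>U i\<close>, so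
    two such points are at most \<open>t i\<close> apart.\<close>
  define V where "V i = (\<Union>x\<in>U i. ball x ((t i - ?d i) / 2))" for i
  have dV: "dist x y \<le> t i" if xy: "x \<in> V i" "y \<in> V i" for i x y
  proof -
    obtain a b where ab: "a \<in> U i" "b \<in> U i" "dist a x < (t i - ?d i) / 2" "dist b y < (t i - ?d i) / 2"
      using xy by (auto simp: V_def)
    have "dist x y \<le> dist a x + dist a b + dist b y"
      using dist_triangle[of x y a] dist_triangle[of a y b] by (simp add: dist_commute)
    moreover have "dist a b \<le> ?d i" using diameter_bounded_bound[OF bd ab(1,2)] .
    ultimately show ?thesis using ab(3,4) by argo
  qed
  have "U i \<subseteq> V i" for i using t(1)[of i] by (force simp: V_def)
  then have "X \<subseteq> (\<Union>i. V i)" using U by (force simp: hausdorff_covers_def)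
  moreover have "open (V i)" for i by (auto simp: V_def)
  ultimately obtain I where I: "finite I" "X \<subseteq> (\<Union>i\<in>I. V i)"
    using compactE_image[OF X, of UNIV V] by auto
  have gU: "?d i powr s \<le> hausdorff_gauge s (U i)" for i
    using s by (auto simp: hausdorff_gauge_def)
  have "ennreal (\<Sum>i\<in>I. hausdorff_gauge s (U i)) = (\<Sum>i\<in>I. ennreal (hausdorff_gauge s (U i)))"
    by (simp add: hausdorff_gauge_nonneg)
  also have "\<dots> \<le> (\<Sum>i. ennreal (hausdorff_gauge s (U i)))" using I(1) by (intro sum_le_suminf) auto
  also have "\<dots> \<le> ennreal (c / 2)" using lt by simp
  finally have 1: "(\<Sum>i\<in>I. hausdorff_gauge s (U i)) \<le> c / 2" using c by (simp add: ennreal_le_iff)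
  have 2: "(\<Sum>i\<in>I. ?a i) \<le> c / 2"
  proof -
    have "?a sums (c / 2)" using sums_mult[OF power_half_series, of "c / 2"] by simp
    then show ?thesis using I(1) c sum_le_suminf[of ?a I] by (auto simp: sums_iff)
  qed
  have "(\<Sum>i\<in>I. t i powr s) \<le> (\<Sum>i\<in>I. hausdorff_gauge s (U i) + ?a i)"
    using t(2) gU by (intro sum_mono) (meson add_right_mono order_trans)
  also have "\<dots> \<le> c" using 1 2 by (simp add: sum.distrib)
  finally have "(\<Sum>i\<in>I. t i powr s) \<le> c" .
  moreover have "0 < t i" for i using t(1)[of i] diameter_ge_0[OF bd[of i]] by linarith
  ultimately show thesis using that[of I V t] I dV by blast
qed

section \<open>Subsets at a positive distance from their complement\<close>

text \<open>A quantitative form of being clopen. In a compact space every clopen set has some gap,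
  while for a fixed gap only finitely many subsets exist; the finiteness of the set of density
  ratios rests on the latter.\<close>

definition gap :: "real \<Rightarrow> 'a::metric_space set \<Rightarrow> 'a set \<Rightarrow> bool" where
  "gap e X S \<longleftrightarrow> S \<subseteq> X \<and> (\<forall>x\<in>S. \<forall>y\<in>X. dist x y < e \<longrightarrow> y \<in> S)"

lemma gap_imp_clopen_in:
  assumes "gap e X S" "0 < e"
  shows "clopen_in X S"
proof -
  have op: "openin (top_of_set X) S"
    unfolding openin_euclidean_subtopology_iff using assms by (auto simp: gap_def dist_commute)
  have "openin (top_of_set X) (X - S)"
    unfolding openin_euclidean_subtopology_iff using assms by (auto simp: gap_def dist_commute)
  then have "closedin (top_of_set X) S"
    using assms(1) by (simp add: closedin_def gap_def)
  with op show ?thesis by (simp add: clopen_in_def)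
qed

text \<open>The gap is a Lebesgue number of the cover by two open sets that cut out \<open>S\<close>
  and its complement.\<close>

lemma clopen_in_imp_gap:
  fixes X :: "'a::metric_space set"
  assumes "compact X" "clopen_in X S"
  obtains e where "0 < e" "gap e X S"
proof -
  have op: "openin (top_of_set X) S" "openin (top_of_set X) (X - S)"
    using assms(2) by (auto simp: clopen_in_def closedin_def)
  then obtain G H where G: "open G" "S = X \<inter> G" and H: "open H" "X - S = X \<inter> H"
    by (auto simp: openin_open)
  have "X \<subseteq> \<Union>{G,H}"
  proof
    fix x assume x: "x \<in> X"
    show "x \<in> \<Union>{G,H}"
    proof (cases "x \<in> S")
      case False
      then have "x \<in> X \<inter> H" using x unfolding H(2)[symmetric] by simp
      then show ?thesis by simp
    qed (use G(2) in simp)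
  qed
  then obtain e where e: "0 < e" "\<And>x. x \<in> X \<Longrightarrow> \<exists>B\<in>{G,H}. ball x e \<subseteq> B"
    using Heine_Borel_lemma[OF assms(1), of "{G,H}"] G(1) H(1) by (metis empty_iff insert_iff)
  have "y \<in> S" if "x \<in> S" "y \<in> X" "dist x y < e" for x y
  proof -
    have mem: "x \<in> ball x e" "y \<in> ball x e" using that e(1) by auto
    have x: "x \<in> X" using that(1) G(2) by simp
    have "x \<notin> X \<inter> H" using that(1) unfolding H(2)[symmetric] by simp
    then have "x \<notin> H" using x by simp
    with mem(1) have "\<not> ball x e \<subseteq> H" by (meson subsetD)
    with e(2)[OF x] have "ball x e \<subseteq> G" by simp
    with mem(2) have "y \<in> G" by (rule rev_subsetD)
    then show ?thesis using G(2) that(2) by blast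
  qed
  then have "gap e X S" using G(2) by (auto simp: gap_def)
  with e(1) show thesis by (rule that)
qed

text \<open>Two points of one ball of radius \<open>e / 2\<close> are less than \<open>e\<close>
  apart, so a set with gap \<open>e\<close> contains all or nothing of the trace of such a ball. It
  is thus determined by a subset of a finite family of balls covering \<open>X\<close>.\<close>

lemma finite_gap_sets:
  fixes X :: "'a::metric_space set"
  assumes "compact X" "0 < e"
  shows "finite {S. gap e X S}"
proof -
  obtain P where P: "finite P" "X \<subseteq> (\<Union>p\<in>P. ball p (e / 2))"
  proof (rule compactE_image[OF assms(1), of UNIV "\<lambda>p. ball p (e / 2)"])
    show "X \<subseteq> (\<Union>p. ball p (e / 2))" 
    proof
      fix x assume "x \<in> X"
      have "x \<in> ball x (e / 2)" using assms(2) by simp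
      then show "x \<in> (\<Union>p. ball p (e / 2))" by (rule UN_I[OF UNIV_I])
    qed
  qed auto
  define F where "F Q = (\<Union>p\<in>Q. X \<inter> ball p (e / 2))" for Q
  have "S = F {p\<in>P. ball p (e / 2) \<inter> S \<noteq> {}}" if S: "gap e X S" for S
  proof -
    have close: "y \<in> S" if "x \<in> S" "y \<in> X" "dist p x < e / 2" "dist p y < e / 2" for x y p
    proof -
      have "dist x y < e" using that by (metis dist_commute dist_triangle_half_l)
      then show ?thesis using S that by (auto simp: gap_def)
    qed
    have "x \<in> F {p\<in>P. ball p (e / 2) \<inter> S \<noteq> {}}" if "x \<in> S" for x
    proof -
      have "x \<in> X" using S that by (auto simp: gap_def)
      then obtain p where p: "p \<in> P" "x \<in> ball p (e / 2)" using P(2) by blast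
      then have "p \<in> {p\<in>P. ball p (e / 2) \<inter> S \<noteq> {}}" using that by (auto simp del: mem_ball)
      then show ?thesis unfolding F_def by (rule UN_I) (use p \<open>x \<in> X\<close> in simp)
    qed
    moreover have "y \<in> S" if y: "y \<in> F {p\<in>P. ball p (e / 2) \<inter> S \<noteq> {}}" for y
    proof -
      obtain p where p: "y \<in> X" "y \<in> ball p (e / 2)" "ball p (e / 2) \<inter> S \<noteq> {}"
        using y by (auto simp: F_def simp del: mem_ball)
      then obtain x where "x \<in> S" "dist p x < e / 2" by auto
      then show ?thesis using close[of x y p] p(1,2) by simp
    qed
    ultimately show ?thesis by (intro set_eqI iffI)
  qed
  then have "{S. gap e X S} \<subseteq> F ` Pow P" by blast
  then show ?thesis using P(1) by (auto intro: finite_subset)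
qed

lemma gap_imp_measurable:
  fixes X :: "'a::metric_space set"
  assumes "gap e X S" "0 < e" "0 \<le> s"
  shows "S \<in> sets (hausdorff_measure s X)"
proof -
  have "hausdorff_outer s (S \<inter> Y) + hausdorff_outer s ((X - S) \<inter> Y) = hausdorff_outer s Y"
    if "Y \<subseteq> X" for Y
  proof -
    have "hausdorff_outer s ((S \<inter> Y) \<union> ((X - S) \<inter> Y))
        = hausdorff_outer s (S \<inter> Y) + hausdorff_outer s ((X - S) \<inter> Y)"
      using assms by (intro hausdorff_outer_separated[of e]) (auto simp: gap_def not_less[symmetric])
    moreover have "(S \<inter> Y) \<union> ((X - S) \<inter> Y) = Y" using that by blast
    ultimately show ?thesis by simp
  qed
  then show ?thesis
    using assms(1) by (auto simp: sets_hausdorff_measure lambda_system_def gap_def)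
qed

lemma hausdorff_pre_UN_le:
  assumes "finite I" "0 < \<epsilon>"
  shows "hausdorff_pre s \<epsilon> (\<Union>i\<in>I. F i) \<le> (\<Sum>i\<in>I. hausdorff_pre s \<epsilon> (F i))"
  using assms(1)
proof (induction I)
  case empty
  then show ?case using assms(2) by (simp add: hausdorff_pre_empty)
next
  case (insert i I)
  let ?B = "binaryset (F i) (\<Union>i\<in>I. F i)"
  have "hausdorff_pre s \<epsilon> (\<Union>n. ?B n) \<le> (\<Sum>n. hausdorff_pre s \<epsilon> (?B n))"
    by (rule hausdorff_pre_countably_subadditive)
  also have "\<dots> = hausdorff_pre s \<epsilon> (F i) + hausdorff_pre s \<epsilon> (\<Union>i\<in>I. F i)"
    using assms(2) by (intro suminf_binaryset_eq hausdorff_pre_empty)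
  also have "\<dots> \<le> hausdorff_pre s \<epsilon> (F i) + (\<Sum>i\<in>I. hausdorff_pre s \<epsilon> (F i))"
    by (intro add_left_mono insert.IH)
  finally show ?case using insert.hyps by (simp add: UN_binaryset_eq)
qed

lemma hausdorff_outer_UN_le:
  assumes "finite I"
  shows "hausdorff_outer s (\<Union>i\<in>I. F i) \<le> (\<Sum>i\<in>I. hausdorff_outer s (F i))"
  using assms
proof (induction I)
  case (insert i I)
  have "hausdorff_outer s (F i \<union> (\<Union>i\<in>I. F i)) \<le> hausdorff_outer s (F i) + hausdorff_outer s (\<Union>i\<in>I. F i)"
    by (rule hausdorff_outer_Un_le)
  also have "\<dots> \<le> hausdorff_outer s (F i) + (\<Sum>i\<in>I. hausdorff_outer s (F i))"
    by (intro add_left_mono insert.IH)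
  finally show ?case using insert.hyps by simp
qed (simp add: hausdorff_outer_empty)

lemma INF_ennreal_eq_Inf:
  fixes S :: "real set"
  assumes "S \<noteq> {}" "\<And>s. s \<in> S \<Longrightarrow> 0 \<le> s"
  shows "(INF s\<in>S. ennreal s) = ennreal (Inf S)"
proof (rule antisym)
  have bdd: "bdd_below S" unfolding bdd_below_def using assms(2) by blast
  show "ennreal (Inf S) \<le> (INF s\<in>S. ennreal s)"
    using bdd by (intro INF_greatest ennreal_leI cInf_lower)
  have pos: "0 \<le> Inf S" using assms by (intro cInf_greatest)
  show "(INF s\<in>S. ennreal s) \<le> ennreal (Inf S)"
  proof (rule ennreal_le_epsilon)
    fix e :: real assume e: "0 < e"
    obtain s where s: "s \<in> S" "s < Inf S + e"
      using cInf_lessD[OF assms(1), of "Inf S + e"] e by auto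
    have "(INF s\<in>S. ennreal s) \<le> ennreal s" using s(1) by (rule INF_lower)
    also have "\<dots> \<le> ennreal (Inf S + e)" using s(2) by (intro ennreal_leI) simp
    finally show "(INF s\<in>S. ennreal s) \<le> ennreal (Inf S) + ennreal e" using pos e by simp
  qed
qed

text \<open>The first \<open>p + 1\<close> values bound the whole sequence, and every further window
  of length \<open>p\<close> halves the bound.\<close>

lemma halving_imp_small:
  fixes Y :: "nat \<Rightarrow> real"
  assumes nonneg: "\<And>n. 0 \<le> Y n" and half: "\<And>n. p \<le> n \<Longrightarrow> \<exists>i\<in>{n - p..n}. Y n \<le> Y i / 2"
    and e: "0 < e"
  shows "\<exists>n. Y n < e"
proof -
  define B where "B = Max (Y ` {..p})"
  have le_B: "Y n \<le> B" if "n \<le> p" for n using that by (auto simp: B_def)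
  have B: "0 \<le> B" using le_B[of 0] nonneg[of 0] by simp
  have bound: "Y n \<le> B" for n
  proof (induction n rule: less_induct)
    case (less n)
    show ?case
    proof (cases "n \<le> p")
      case False
      then obtain i where i: "i \<le> n" "Y n \<le> Y i / 2" using half[of n] by auto
      show ?thesis
      \<comment> \<open>The window contains \<open>n\<close> itself; in that case the halving
        inequality forces \<open>Y n\<close> to be 0.\<close>
      proof (cases "i = n")
        case False
        then show ?thesis using less[of i] i B nonneg[of i] by simp
      qed (use i nonneg[of n] B in simp)
    qed (rule le_B)
  qed
  have "\<exists>N. \<forall>n\<ge>N. Y n \<le> B / 2 ^ l" for l
  proof (induction l)
    case 0
    then show ?case using bound by simp
  next
    case (Suc l)
    then obtain N where N: "\<And>n. N \<le> n \<Longrightarrow> Y n \<le> B / 2 ^ l" by blast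
    have "Y n \<le> B / 2 ^ Suc l" if n: "N + p \<le> n" for n
    proof -
      obtain i where i: "n - p \<le> i" "Y n \<le> Y i / 2" using half[of n] n by auto
      have "Y i \<le> B / 2 ^ l" using i(1) n by (intro N) linarith
      then show ?thesis using i(2) by simp
    qed
    then show ?case by blast
  qed
  moreover obtain l where "B / 2 ^ l < e"
  proof -
    have "(\<lambda>l. B * (1 / 2) ^ l) \<longlonglongrightarrow> B * 0" by (intro tendsto_mult LIMSEQ_power_zero tendsto_const) simp
    then have "\<forall>\<^sub>F l in sequentially. B * (1 / 2) ^ l < e" using e by (intro order_tendstoD(2)) auto
    then show thesis using that by (auto simp: eventually_sequentially power_divide)
  qed
  ultimately show ?thesis by (meson le_less_trans order_refl)
qed

lemma gap_subset: "gap e X S \<Longrightarrow> S \<subseteq> Y \<Longrightarrow> Y \<subseteq> X \<Longrightarrow> gap e Y S"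
  by (auto simp: gap_def)

lemma hausdorff_outer_split:
  assumes "S \<in> sets (hausdorff_measure s X)" "Y \<subseteq> X"
  shows "hausdorff_outer s (S \<inter> Y) + hausdorff_outer s ((X - S) \<inter> Y) = hausdorff_outer s Y"
  using assms unfolding sets_hausdorff_measure lambda_system_def by blast

section \<open>The expanding map of a multi-model Cantor set\<close>

context multi_model_cantor_set
begin

lemma compact: "compact C" and C_ne: "C \<noteq> {}" and perfect: "x \<in> C \<Longrightarrow> x islimpt C"
  using cantor by (auto simp: cantor_set_def)

lemma model_subset: "A j \<subseteq> C" and model_ne: "A j \<noteq> {}" and UN_models: "(\<Union>j. A j) = C"
  using models by (auto simp: clopen_partition_def)

lemma clone_subset: "E k \<subseteq> C" and UN_clones: "(\<Union>k. E k) = C"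
  using clones by (auto simp: clopen_partition_def)

lemma model_eq: "x \<in> A i \<Longrightarrow> x \<in> A j \<Longrightarrow> i = j"
  using models by (auto simp: clopen_partition_def disjoint_family_on_def)

lemma clone_eq: "x \<in> E i \<Longrightarrow> x \<in> E j \<Longrightarrow> i = j"
  using clones by (auto simp: clopen_partition_def disjoint_family_on_def)

lemma clone_subset_model: "x \<in> E k \<Longrightarrow> x \<in> A j \<Longrightarrow> E k \<subseteq> A j"
  using clone_in_model[of k] model_eq by blast

text \<open>The choice is unambiguous because the models are non-empty and disjoint.\<close>

definition ty :: "'m \<Rightarrow> 'n" where "ty k = (SOME j. similarity_map (r k) (E k) (A j) (\<tau> k))"

lemma similarity: "similarity_map (r k) (E k) (A (ty k)) (\<tau> k)"
  unfolding ty_def using clone_map by (rule someI_ex)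

lemma image_clone: "\<tau> k ` E k = A (ty k)"
  and dist_tau: "x \<in> E k \<Longrightarrow> y \<in> E k \<Longrightarrow> dist (\<tau> k x) (\<tau> k y) = r k * dist x y"
  using similarity by (auto simp: similarity_map_def)

lemma r_pos: "0 < r k" using scale_gt_1[of k] by simp

definition \<kappa> :: "'a \<Rightarrow> 'm" where "\<kappa> x = (SOME k. x \<in> E k)"

definition T :: "'a \<Rightarrow> 'a" where "T x = \<tau> (\<kappa> x) x"

lemma in_clone: "x \<in> C \<Longrightarrow> x \<in> E (\<kappa> x)"
  unfolding \<kappa>_def using UN_clones by (metis UN_E someI)

lemma kappa_eq: "x \<in> E k \<Longrightarrow> \<kappa> x = k"
  using in_clone[of x] clone_subset clone_eq by blast

lemma clone_eq_kappa: "E k = {x\<in>C. \<kappa> x = k}"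
  using kappa_eq in_clone clone_subset by blast

lemma T_in: "x \<in> C \<Longrightarrow> T x \<in> C"
  unfolding T_def using in_clone[of x] image_clone[of "\<kappa> x"] model_subset by blast

lemma T_funpow_in: "x \<in> C \<Longrightarrow> (T ^^ n) x \<in> C"
  by (induction n) (auto simp: T_in)

lemma dist_T: "x \<in> C \<Longrightarrow> y \<in> C \<Longrightarrow> \<kappa> x = \<kappa> y \<Longrightarrow> dist (T x) (T y) = r (\<kappa> x) * dist x y"
  unfolding T_def using dist_tau in_clone by metis

section \<open>Iterates of the expanding map and level-n clones\<close>

definition scl :: "nat \<Rightarrow> 'a \<Rightarrow> real" where "scl n x = (\<Prod>i<n. r (\<kappa> ((T ^^ i) x)))"

text \<open>Clones are encoded by itineraries: the points whose first \<open>n\<close> symbols agree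
  with those of \<open>x\<close>. Any point of a clone can thus serve as its name, in place of a
  word of clone indices.\<close>

definition clone :: "nat \<Rightarrow> 'a \<Rightarrow> 'a set" where
  "clone n x = {y\<in>C. \<forall>i<n. \<kappa> ((T ^^ i) y) = \<kappa> ((T ^^ i) x)}"

lemma scl_0 [simp]: "scl 0 x = 1" and clone_0 [simp]: "clone 0 x = C"
  by (auto simp: scl_def clone_def)

lemma scl_Suc: "scl (Suc n) x = scl n x * r (\<kappa> ((T ^^ n) x))"
  by (simp add: scl_def)

lemma clone_Suc: "clone (Suc n) x = {y \<in> clone n x. \<kappa> ((T ^^ n) y) = \<kappa> ((T ^^ n) x)}"
  by (auto simp: clone_def less_Suc_eq)

lemma clone_le: "clone n x \<subseteq> C" by (auto simp: clone_def)

lemma clone_self: "x \<in> C \<Longrightarrow> x \<in> clone n x" by (auto simp: clone_def)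

lemma clone_antimono: "m \<le> n \<Longrightarrow> clone n x \<subseteq> clone m x" by (auto simp: clone_def)

lemma clone_cong: "y \<in> clone n x \<Longrightarrow> clone n y = clone n x"
  by (auto simp: clone_def)

lemma scl_cong: "y \<in> clone n x \<Longrightarrow> scl n y = scl n x"
  by (auto simp: clone_def scl_def)

lemma scl_ge_1: "1 \<le> scl n x"
  unfolding scl_def using scale_gt_1 by (intro prod_ge_1) (simp add: less_imp_le)

lemma scl_pos: "0 < scl n x" using scl_ge_1[of n x] by simp

lemma dist_T_funpow:
  assumes "y \<in> clone n x" "z \<in> clone n x"
  shows "dist ((T ^^ n) y) ((T ^^ n) z) = scl n x * dist y z"
  using assms
proof (induction n)
  case (Suc n)
  then have "y \<in> clone n x" "z \<in> clone n x" "\<kappa> ((T ^^ n) y) = \<kappa> ((T ^^ n) z)"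
    "\<kappa> ((T ^^ n) y) = \<kappa> ((T ^^ n) x)"
    by (auto simp: clone_Suc)
  with Suc.IH show ?case
    using clone_le dist_T[of "(T ^^ n) y" "(T ^^ n) z"] T_funpow_in
    by (auto simp: scl_Suc subset_iff)
qed simp

text \<open>A Lebesgue number of the partition into level-1 clones: at smaller distances
  \<open>T\<close> acts as a similarity.\<close>

definition \<rho> :: real where
  "\<rho> = (SOME e. 0 < e \<and> (\<forall>x\<in>C. \<forall>y\<in>C. dist x y < e \<longrightarrow> \<kappa> x = \<kappa> y))"

lemma rho_ex: "\<exists>e>0. \<forall>x\<in>C. \<forall>y\<in>C. dist x y < e \<longrightarrow> \<kappa> x = \<kappa> y"
proof -
  have "\<exists>e>0. gap e C (E k)" for k
    using clopen_in_imp_gap[OF compact, of "E k"] clones by (auto simp: clopen_partition_def)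
  then obtain e where e: "\<And>k. 0 < e k" "\<And>k. gap (e k) C (E k)" by metis
  have "\<kappa> x = \<kappa> y" if "x \<in> C" "y \<in> C" "dist x y < Min (range e)" for x y
  proof -
    have "dist x y < e (\<kappa> x)" using that by simp
    then have "y \<in> E (\<kappa> x)" using e(2)[of "\<kappa> x"] in_clone[OF that(1)] that(2) by (auto simp: gap_def)
    then show ?thesis using kappa_eq by simp
  qed
  moreover have "0 < Min (range e)" using e(1) by simp
  ultimately show ?thesis by blast
qed

lemma rho_pos: "0 < \<rho>" and kappa_eqI: "x \<in> C \<Longrightarrow> y \<in> C \<Longrightarrow> dist x y < \<rho> \<Longrightarrow> \<kappa> x = \<kappa> y"
proof -
  have *: "0 < \<rho> \<and> (\<forall>x\<in>C. \<forall>y\<in>C. dist x y < \<rho> \<longrightarrow> \<kappa> x = \<kappa> y)"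
    unfolding \<rho>_def using rho_ex by (rule someI_ex)
  show "0 < \<rho>" using * by (rule conjunct1)
  show "x \<in> C \<Longrightarrow> y \<in> C \<Longrightarrow> dist x y < \<rho> \<Longrightarrow> \<kappa> x = \<kappa> y"
    using conjunct2[OF *] by simp
qed

text \<open>While two orbits share their symbols, \<open>T\<close> multiplies their distance by
  known factors. Points of \<open>C\<close> closer than \<open>\<rho> / scl n x\<close> therefore
  stay closer than \<open>\<rho>\<close> and cannot be separated during the first \<open>n\<close>
  steps.\<close>

lemma gap_clone: "gap (\<rho> / scl n x) C (clone n x)"
  unfolding gap_def
proof (intro conjI ballI impI clone_le)
  fix y z assume "y \<in> clone n x" "z \<in> C" "dist y z < \<rho> / scl n x"
  then show "z \<in> clone n x"
  proof (induction n)
    case (Suc n)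
    have le: "scl n x \<le> scl (Suc n) x"
      using scl_pos[of n x] scale_gt_1[of "\<kappa> ((T ^^ n) x)"] by (simp add: scl_Suc)
    have y: "y \<in> clone n x" "y \<in> C" using Suc.prems(1) clone_le by (auto simp: clone_Suc)
    have d: "dist y z < \<rho> / scl n x"
      using Suc.prems(3) divide_left_mono[OF le, of \<rho>] rho_pos scl_pos by (simp add: less_imp_le)
    with Suc y have z: "z \<in> clone n x" by blast
    have "dist ((T ^^ n) y) ((T ^^ n) z) = scl n x * dist y z" using y z by (intro dist_T_funpow)
    also have "\<dots> < \<rho>" using d scl_pos[of n x] by (simp add: field_simps)
    finally have "\<kappa> ((T ^^ n) y) = \<kappa> ((T ^^ n) z)"
      using y(2) Suc.prems(2) by (intro kappa_eqI T_funpow_in)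
    then show ?case using z Suc.prems(1) by (simp add: clone_Suc)
  qed simp
qed

lemma gap_clone_pos: "0 < \<rho> / scl n x" using rho_pos scl_pos by simp

text \<open>The point \<open>z\<close> is pulled back along the orbit of \<open>x\<close>: being
  within \<open>\<rho>\<close> of an orbit point, it lies in the same level-1 clone, hence in the
  same model, hence in the range of the clone map just applied. Pulling back contracts, so the
  condition persists.\<close>

lemma T_funpow_onto:
  assumes "x \<in> C" "z \<in> C" "dist ((T ^^ n) x) z < \<rho>"
  shows "\<exists>y\<in>clone n x. (T ^^ n) y = z"
  using assms
proof (induction n arbitrary: z)
  case (Suc n)
  let ?k = "\<kappa> ((T ^^ n) x)"
  have Tx: "(T ^^ n) x \<in> C" "(T ^^ n) x \<in> E ?k" using Suc.prems(1) T_funpow_in in_clone by auto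
  have TTx: "(T ^^ Suc n) x \<in> A (ty ?k)" using Tx image_clone[of ?k] by (auto simp: T_def)
  have "\<kappa> ((T ^^ Suc n) x) = \<kappa> z"
    using Suc.prems T_funpow_in[OF Suc.prems(1), of "Suc n"] by (intro kappa_eqI) auto
  then have "z \<in> A (ty ?k)"
    using TTx clone_subset_model in_clone[OF Suc.prems(2)] in_clone[OF T_funpow_in[OF Suc.prems(1), of "Suc n"]]
    by (metis subsetD)
  then obtain w where w: "w \<in> E ?k" "\<tau> ?k w = z" using image_clone by (metis imageE)
  have w': "w \<in> C" "\<kappa> w = ?k" "T w = z" using w clone_subset kappa_eq by (auto simp: T_def)
  have "dist ((T ^^ Suc n) x) z = r ?k * dist ((T ^^ n) x) w"
    using dist_T[OF Tx(1) w'(1)] w' by simp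
  then have "r ?k * dist ((T ^^ n) x) w < \<rho>" using Suc.prems(3) by simp
  moreover have "dist ((T ^^ n) x) w \<le> r ?k * dist ((T ^^ n) x) w"
    using scale_gt_1[of ?k] mult_right_mono[of 1 "r ?k" "dist ((T ^^ n) x) w"] by simp
  ultimately have "dist ((T ^^ n) x) w < \<rho>" by simp
  then obtain y where "y \<in> clone n x" "(T ^^ n) y = w" using Suc.IH[OF Suc.prems(1) w'(1)] by auto
  then show ?case using w' by (intro bexI[of _ y]) (auto simp: clone_Suc)
qed simp

text \<open>The two claims feed each other. A level-1 clone meeting a model lies inside it, so
  cutting the expanded clone by its next symbol leaves a whole level-1 clone, and \<open>T\<close>
  maps that onto a whole model. Level 0 accounts for \<open>C\<close> itself.\<close>

lemma T_funpow_clone: "x \<in> C \<Longrightarrow> (T ^^ n) ` clone n x \<in> insert C (range A)"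
  and T_funpow_clone_Suc: "x \<in> C \<Longrightarrow> (T ^^ n) ` clone (Suc n) x = E (\<kappa> ((T ^^ n) x))"
proof -
  have step: "(T ^^ n) ` clone (Suc n) x = E (\<kappa> ((T ^^ n) x))"
    if x: "x \<in> C" and im: "(T ^^ n) ` clone n x \<in> insert C (range A)" for n
  proof -
    let ?k = "\<kappa> ((T ^^ n) x)"
    have "(T ^^ n) ` clone (Suc n) x = (T ^^ n) ` clone n x \<inter> E ?k"
      using clone_le T_funpow_in by (force simp: clone_Suc clone_eq_kappa)
    moreover have "E ?k \<subseteq> (T ^^ n) ` clone n x"
    proof -
      have "(T ^^ n) x \<in> (T ^^ n) ` clone n x" "(T ^^ n) x \<in> E ?k"
        using x clone_self T_funpow_in in_clone by auto
      then show ?thesis using im clone_subset clone_subset_model by (metis imageE insertE)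
    qed
    ultimately show ?thesis by blast
  qed
  have im: "(T ^^ n) ` clone n x \<in> insert C (range A)" if x: "x \<in> C" for n
  proof (induction n)
    case (Suc n)
    let ?k = "\<kappa> ((T ^^ n) x)"
    have "(T ^^ Suc n) ` clone (Suc n) x = T ` (T ^^ n) ` clone (Suc n) x"
      by (simp add: image_comp comp_def)
    also have "\<dots> = T ` E ?k" using step[OF x Suc] by simp
    also have "\<dots> = \<tau> ?k ` E ?k" by (rule image_cong) (auto simp: T_def kappa_eq)
    finally show ?case using image_clone by simp
  qed simp
  then show "x \<in> C \<Longrightarrow> (T ^^ n) ` clone n x \<in> insert C (range A)" .
  then show "x \<in> C \<Longrightarrow> (T ^^ n) ` clone (Suc n) x = E (\<kappa> ((T ^^ n) x))" using step by blast
qed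

text \<open>Perfectness enters here. The second point later guarantees that the image of a clone is
  split at some finite level of \<open>C'\<close>.\<close>

lemma clone_two_points:
  assumes "x \<in> C"
  obtains y where "y \<in> clone n x" "y \<noteq> x"
proof -
  obtain y where "y \<in> C" "y \<noteq> x" "dist y x < \<rho> / scl n x"
    using perfect[OF assms] gap_clone_pos[of n x] unfolding islimpt_approachable by blast
  moreover from this have "y \<in> clone n x"
    using gap_clone[of n x] clone_self[OF assms] unfolding gap_def by (metis dist_commute)
  ultimately show thesis using that by blast
qed

definition rmax :: real where "rmax = Max (range r)"
definition rmin :: real where "rmin = Min (range r)"

lemma r_le: "r k \<le> rmax" and r_ge: "rmin \<le> r k" by (auto simp: rmax_def rmin_def)

lemma rmin_gt_1: "1 < rmin" using scale_gt_1 by (auto simp: rmin_def)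

lemma rmax_gt_1: "1 < rmax" using scale_gt_1[of undefined] r_le[of undefined] by simp

lemma scl_ge_power: "rmin ^ n \<le> scl n x"
proof -
  have "(\<Prod>i<n. rmin) \<le> scl n x"
    unfolding scl_def using r_ge rmin_gt_1 by (intro prod_mono) auto
  then show ?thesis by simp
qed

definition \<Delta> :: real where "\<Delta> = (SOME D. 0 < D \<and> (\<forall>x\<in>C. \<forall>y\<in>C. dist x y \<le> D))"

lemma Delta_pos: "0 < \<Delta>" and dist_le_Delta: "x \<in> C \<Longrightarrow> y \<in> C \<Longrightarrow> dist x y \<le> \<Delta>"
proof -
  obtain D where D: "\<And>x y. x \<in> C \<Longrightarrow> y \<in> C \<Longrightarrow> dist x y \<le> D"
    using compact_imp_bounded[OF compact] unfolding bounded_two_points by blast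
  then have "\<exists>D. 0 < D \<and> (\<forall>x\<in>C. \<forall>y\<in>C. dist x y \<le> D)"
    by (intro exI[of _ "max 1 D"]) (auto simp: le_max_iff_disj)
  from someI_ex[OF this, folded \<Delta>_def]
  show "0 < \<Delta>" "x \<in> C \<Longrightarrow> y \<in> C \<Longrightarrow> dist x y \<le> \<Delta>" by auto
qed

lemma dist_clone_le: "y \<in> clone n x \<Longrightarrow> z \<in> clone n x \<Longrightarrow> dist y z \<le> \<Delta> / scl n x"
proof -
  assume yz: "y \<in> clone n x" "z \<in> clone n x"
  then have "scl n x * dist y z \<le> \<Delta>"
    using dist_T_funpow[OF yz] dist_le_Delta T_funpow_in clone_le by (metis subsetD)
  then show ?thesis using scl_pos[of n x] by (simp add: field_simps)
qed

lemma finite_clones: "finite (clone n ` C)"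
proof (induction n)
  case (Suc n)
  have "clone (Suc n) ` C \<subseteq> (\<lambda>(S, k). {y\<in>S. \<kappa> ((T ^^ n) y) = k}) ` (clone n ` C \<times> UNIV)"
    by (auto simp: clone_Suc)
  then show ?case by (rule finite_subset) (intro finite_imageI finite_cartesian_product Suc finite)
qed (auto intro: finite_subset[of _ "{C}"])

lemma clones_nested: "m \<le> n \<Longrightarrow> clone m x \<inter> clone n y \<noteq> {} \<Longrightarrow> clone n y \<subseteq> clone m x"
  using clone_antimono[of m n y] by (auto simp: clone_def)

lemma clone_measurable: "0 \<le> s \<Longrightarrow> clone n x \<in> sets (hausdorff_measure s C)"
  by (rule gap_imp_measurable[OF gap_clone gap_clone_pos])

lemma outer_T_funpow:
  assumes "0 \<le> s" "S \<subseteq> clone n x"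
  shows "hausdorff_outer s ((T ^^ n) ` S) = ennreal (scl n x powr s) * hausdorff_outer s S"
  using assms by (intro similarity_image_outer scl_pos dist_T_funpow) auto

end

section \<open>Weighted clone counts and the critical exponent\<close>

context multi_model_cantor_set
begin

text \<open>For \<open>V\<close> inside \<open>C\<close> this is the number of
  level-\<open>n\<close> clones meeting \<open>V\<close>, each weighted by the inverse of its scale
  factor to the power \<open>d\<close>. On the model \<open>A j\<close> it is the
  \<open>j\<close>-th column sum of the \<open>n\<close>-th power of the clone matrix. Allowing any
  \<open>V\<close> makes it applicable to members of covers.\<close>

primrec wsum :: "real \<Rightarrow> nat \<Rightarrow> 'a set \<Rightarrow> real" where
  "wsum d 0 V = (if V = {} then 0 else 1)"
| "wsum d (Suc n) V = (\<Sum>k\<in>UNIV. (1 / r k) powr d * wsum d n (\<tau> k ` (V \<inter> E k)))"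

lemma wsum_nonneg: "0 \<le> wsum d n V"
  by (induction n arbitrary: V) (auto intro!: sum_nonneg)

lemma wsum_empty [simp]: "wsum d n {} = 0"
  by (induction n) auto

lemma wsum_mono: "V \<subseteq> W \<Longrightarrow> wsum d n V \<le> wsum d n W"
proof (induction n arbitrary: V W)
  case (Suc n)
  have "wsum d n (\<tau> k ` (V \<inter> E k)) \<le> wsum d n (\<tau> k ` (W \<inter> E k))" for k
    using Suc.prems by (intro Suc.IH) auto
  then show ?case by (auto intro!: sum_mono mult_left_mono)
qed auto

lemma wsum_Un_le: "wsum d n (V \<union> W) \<le> wsum d n V + wsum d n W"
proof (induction n arbitrary: V W)
  case (Suc n)
  have "wsum d n (\<tau> k ` ((V \<union> W) \<inter> E k)) \<le> wsum d n (\<tau> k ` (V \<inter> E k)) + wsum d n (\<tau> k ` (W \<inter> E k))" for k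
    using Suc.IH[of "\<tau> k ` (V \<inter> E k)" "\<tau> k ` (W \<inter> E k)"] by (simp add: Int_Un_distrib2 image_Un)
  then have "wsum d (Suc n) (V \<union> W) \<le> (\<Sum>k\<in>UNIV. (1 / r k) powr d * (wsum d n (\<tau> k ` (V \<inter> E k)) + wsum d n (\<tau> k ` (W \<inter> E k))))"
    by (auto intro!: sum_mono mult_left_mono)
  then show ?case by (simp add: distrib_left sum.distrib)
qed auto

lemma wsum_UN_le: "finite I \<Longrightarrow> wsum d n (\<Union>i\<in>I. V i) \<le> (\<Sum>i\<in>I. wsum d n (V i))"
proof (induction I rule: finite_induct)
  case (insert i I)
  then show ?case using wsum_Un_le[of d n "V i" "\<Union>i\<in>I. V i"] by simp
qed simp

lemma model_Int_clone: "A j \<inter> E k = (if E k \<subseteq> A j then E k else {})"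
  using clone_subset_model by auto

lemma wsum_model_Suc:
  "wsum d (Suc n) (A j) = (\<Sum>k | E k \<subseteq> A j. (1 / r k) powr d * wsum d n (A (ty k)))"
proof -
  have "wsum d (Suc n) (A j) = (\<Sum>k\<in>UNIV. if E k \<subseteq> A j then (1 / r k) powr d * wsum d n (A (ty k)) else 0)"
    unfolding wsum.simps by (intro sum.cong) (auto simp: model_Int_clone image_clone)
  then show ?thesis by (simp add: sum.If_cases)
qed

text \<open>Expanding a level-\<open>m\<close> clone inside a model turns it into a model, whose
  level-\<open>n\<close> clones then account for those of level \<open>m + n\<close>.\<close>

lemma wsum_submult:
  assumes "\<And>j. wsum d n (A j) \<le> a"
  shows "wsum d (m + n) (A j) \<le> a * wsum d m (A j)"
proof (induction m arbitrary: j)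
  case (Suc m)
  have "wsum d (Suc m + n) (A j) = (\<Sum>k | E k \<subseteq> A j. (1 / r k) powr d * wsum d (m + n) (A (ty k)))"
    unfolding add_Suc wsum_model_Suc ..
  also have "\<dots> \<le> (\<Sum>k | E k \<subseteq> A j. (1 / r k) powr d * (a * wsum d m (A (ty k))))"
    by (intro sum_mono mult_left_mono Suc) simp
  also have "\<dots> = a * wsum d (Suc m) (A j)"
    unfolding wsum_model_Suc by (simp add: sum_distrib_left mult_ac)
  finally show ?case .
qed (use assms model_ne in simp)

lemma wsum_supermult:
  assumes "\<And>j. a \<le> wsum d n (A j)"
  shows "a * wsum d m (A j) \<le> wsum d (m + n) (A j)"
proof (induction m arbitrary: j)
  case (Suc m)
  have "a * wsum d (Suc m) (A j) = (\<Sum>k | E k \<subseteq> A j. (1 / r k) powr d * (a * wsum d m (A (ty k))))"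
    unfolding wsum_model_Suc by (simp add: sum_distrib_left mult_ac)
  also have "\<dots> \<le> (\<Sum>k | E k \<subseteq> A j. (1 / r k) powr d * wsum d (m + n) (A (ty k)))"
    by (intro sum_mono mult_left_mono Suc) simp
  also have "\<dots> = wsum d (Suc m + n) (A j)"
    unfolding add_Suc wsum_model_Suc ..
  finally show ?case .
qed (use assms model_ne in simp)

lemma wsum_power_le:
  assumes "\<And>j. wsum d n (A j) \<le> a" "0 \<le> a"
  shows "wsum d (l * n) (A j) \<le> a ^ l"
proof (induction l)
  case (Suc l)
  have "wsum d (l * n + n) (A j) \<le> a * wsum d (l * n) (A j)" by (rule wsum_submult[OF assms(1)])
  also have "\<dots> \<le> a * a ^ l" using assms(2) by (intro mult_left_mono Suc)
  finally show ?case by (simp add: add.commute)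
qed (use model_ne in simp)

lemma wsum_power_ge_1:
  assumes "\<And>j. 1 \<le> wsum d n (A j)"
  shows "1 \<le> wsum d (l * n) (A j)"
proof (induction l)
  case (Suc l)
  have "1 * wsum d (l * n) (A j) \<le> wsum d (l * n + n) (A j)" by (rule wsum_supermult[OF assms])
  with Suc show ?case by (simp add: add.commute)
qed (use model_ne in simp)

lemma wsum_antimono_exponent: "d \<le> d' \<Longrightarrow> wsum d' n V \<le> wsum d n V"
proof (induction n arbitrary: V)
  case (Suc n)
  have "(1 / r k) powr d' \<le> (1 / r k) powr d" for k
    using Suc.prems scale_gt_1[of k] by (intro powr_mono') auto
  then show ?case using Suc by (auto intro!: sum_mono mult_mono wsum_nonneg)
qed simp

lemma isCont_wsum: "isCont (\<lambda>d. wsum d n V) d"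
proof (induction n arbitrary: V)
  case (Suc n)
  have "1 / r k \<noteq> 0" for k using r_pos[of k] by simp
  then show ?case unfolding wsum.simps by (intro continuous_intros Suc) auto
qed simp

section \<open>Weighted counts and null sets\<close>

text \<open>A set of diameter below \<open>\<rho>\<close> sits in one level-1 clone and can be
  expanded, which lowers the level by one. Once \<open>t\<close> has grown to \<open>\<rho>\<close>,
  all clones of \<open>C\<close> are counted instead. Each expansion enlarges \<open>t\<close> at
  least by the factor \<open>rmin\<close>, so \<open>p\<close> bounds the number of
  expansions.\<close>

lemma wsum_zoom:
  assumes "0 < d" "V \<subseteq> C" "\<And>x y. x \<in> V \<Longrightarrow> y \<in> V \<Longrightarrow> dist x y \<le> t" "0 < t"
    "\<rho> \<le> t * rmin ^ p" "p \<le> n"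
  shows "\<exists>i\<in>{n - p..n}. wsum d n V \<le> (t / \<rho>) powr d * wsum d i C"
  using assms(2-)
proof (induction p arbitrary: n V t)
  have large: "wsum d n V \<le> (t / \<rho>) powr d * wsum d n C" if "\<rho> \<le> t" "V \<subseteq> C" for n V t
  proof -
    have "1 \<le> (t / \<rho>) powr d" using that rho_pos assms(1) by (intro ge_one_powr_ge_zero) auto
    then have "wsum d n C \<le> (t / \<rho>) powr d * wsum d n C"
      using mult_right_mono wsum_nonneg by fastforce
    then show ?thesis using wsum_mono[OF that(2), of d n] by simp
  qed
  {
    case 0
    then show ?case using large[of t V n] by auto
  next
    case (Suc p)
    show ?case
    proof (cases "\<rho> \<le> t \<or> V = {}")
      case True
      then show ?thesis using large[of t V n] Suc.prems(1) wsum_nonneg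
        by (intro bexI[of _ n]) auto
    next
      case False
      then obtain x where x: "x \<in> V" by auto
      let ?k = "\<kappa> x"
      have VE: "V \<subseteq> E ?k"
      proof
        fix y assume y: "y \<in> V"
        have "dist x y < \<rho>" using Suc.prems(2)[OF x y] False by simp
        then have "\<kappa> x = \<kappa> y" using x y Suc.prems(1) by (intro kappa_eqI) auto
        then show "y \<in> E ?k" using in_clone[of y] y Suc.prems(1) by auto
      qed
      obtain n' where n: "n = Suc n'" using Suc.prems(5) by (cases n) auto
      have "(\<Sum>k\<in>UNIV. (1 / r k) powr d * wsum d n' (\<tau> k ` (V \<inter> E k)))
          = (\<Sum>k\<in>{?k}. (1 / r k) powr d * wsum d n' (\<tau> k ` (V \<inter> E k)))"
      proof (intro sum.mono_neutral_right ballI)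
        fix k assume "k \<in> UNIV - {?k}"
        then have "V \<inter> E k = {}" using VE clone_eq by blast
        then show "(1 / r k) powr d * wsum d n' (\<tau> k ` (V \<inter> E k)) = 0" by simp
      qed auto
      then have eq: "wsum d n V = (1 / r ?k) powr d * wsum d n' (\<tau> ?k ` V)"
        using VE by (simp add: n Int_absorb2)
      have "\<exists>i\<in>{n' - p..n'}. wsum d n' (\<tau> ?k ` V) \<le> (r ?k * t / \<rho>) powr d * wsum d i C"
      proof (rule Suc.IH)
        show "\<tau> ?k ` V \<subseteq> C" using VE image_clone[of ?k] model_subset by blast
        show "0 < r ?k * t" using r_pos Suc.prems(3) by simp
        show "dist x y \<le> r ?k * t" if xy: "x \<in> \<tau> ?k ` V" "y \<in> \<tau> ?k ` V" for x y
        proof -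
          obtain a b where ab: "a \<in> V" "b \<in> V" "x = \<tau> ?k a" "y = \<tau> ?k b" using xy by blast
          have "dist x y = r ?k * dist a b" using ab(1,2) VE dist_tau[of a ?k b] unfolding ab(3,4) by blast
          then show ?thesis using Suc.prems(2)[OF ab(1,2)] r_pos[of ?k] by simp
        qed
        have "t * rmin ^ Suc p \<le> t * (r ?k * rmin ^ p)"
          using Suc.prems(3) r_ge[of ?k] rmin_gt_1 by (auto intro!: mult_left_mono mult_right_mono)
        then show "\<rho> \<le> r ?k * t * rmin ^ p" using Suc.prems(4) by (simp add: mult_ac)
        show "p \<le> n'" using Suc.prems(5) n by simp
      qed
      then obtain i where i: "i \<in> {n' - p..n'}"
        "wsum d n' (\<tau> ?k ` V) \<le> (r ?k * t / \<rho>) powr d * wsum d i C" by blast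
      have "(1 / r ?k) powr d * wsum d n' (\<tau> ?k ` V) \<le> (1 / r ?k) powr d * ((r ?k * t / \<rho>) powr d * wsum d i C)"
        using i(2) by (rule mult_left_mono) simp
      \<comment> \<open>The weight of the clone cancels the growth of \<open>t\<close>: this
        invariance is why the bound has the form \<open>(t / \<rho>) powr d\<close>.\<close>
      also have "\<dots> = (t / \<rho>) powr d * wsum d i C"
        using r_pos[of ?k] Suc.prems(3) rho_pos by (simp add: powr_mult[symmetric] mult.assoc[symmetric])
      finally show ?thesis using i(1) eq n by (intro bexI[of _ i]) auto
    qed
  }
qed

text \<open>A cover whose \<open>d\<close>-th powers sum to at most half of
  \<open>\<rho> powr d\<close> gives, by zooming every member, that the count at level
  \<open>n\<close> is at most half of the largest count among the levels from \<open>n - p\<close>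
  to \<open>n\<close>. Repeated halving drives it below 1.\<close>

lemma null_imp_wsum_less_1:
  assumes "0 < d" "hausdorff_outer d C = 0"
  shows "\<exists>n. \<forall>j. wsum d n (A j) < 1"
proof -
  have c: "0 < \<rho> powr d / 2" using rho_pos by simp
  obtain I :: "nat set" and V t where I: "finite I" "C \<subseteq> (\<Union>i\<in>I. V i)" and t: "\<And>i. 0 < t i"
    "\<And>i x y. x \<in> V i \<Longrightarrow> y \<in> V i \<Longrightarrow> dist x y \<le> t i" "(\<Sum>i\<in>I. t i powr d) \<le> \<rho> powr d / 2"
    by (rule hausdorff_null_finite_open_cover[OF compact assms(2,1) c]) (rule that)
  have "\<exists>p. \<rho> \<le> t i * rmin ^ p" for i
  proof -
    obtain p where "\<rho> / t i < rmin ^ p" using real_arch_pow[OF rmin_gt_1] by blast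
    then show ?thesis using t(1)[of i] by (auto simp: field_simps intro!: exI[of _ p])
  qed
  then obtain p0 where p0: "\<And>i. \<rho> \<le> t i * rmin ^ p0 i" by metis
  \<comment> \<open>Finiteness of the cover gives one number of expansions sufficient for all its
    members, hence a window of fixed length.\<close>
  define p where "p = Max (insert 0 (p0 ` I))"
  have p: "\<rho> \<le> t i * rmin ^ p" if "i \<in> I" for i
  proof -
    have "p0 i \<le> p" using that I(1) by (auto simp: p_def)
    then have "rmin ^ p0 i \<le> rmin ^ p" using rmin_gt_1 by (intro power_increasing) auto
    then show ?thesis using p0[of i] t(1)[of i] by (meson mult_left_mono less_imp_le order_trans)
  qed
  have "\<exists>i\<in>{n - p..n}. wsum d n C \<le> wsum d i C / 2" if n: "p \<le> n" for n
  proof -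
    define m where "m = Max ((\<lambda>i. wsum d i C) ` {n - p..n})"
    have m: "wsum d i C \<le> m" if "i \<in> {n - p..n}" for i using that by (auto simp: m_def)
    have "m \<in> (\<lambda>i. wsum d i C) ` {n - p..n}" unfolding m_def by (intro Max_in) auto
    then obtain i where i: "i \<in> {n - p..n}" "m = wsum d i C" by auto
    have "wsum d n (V l \<inter> C) \<le> (t l / \<rho>) powr d * m" if l: "l \<in> I" for l
    proof -
      obtain i where i: "i \<in> {n - p..n}" "wsum d n (V l \<inter> C) \<le> (t l / \<rho>) powr d * wsum d i C"
        using wsum_zoom[OF assms(1) _ _ t(1) p[OF l] n, of "V l \<inter> C"] t(2) by blast
      have "(t l / \<rho>) powr d * wsum d i C \<le> (t l / \<rho>) powr d * m"
        using m[OF i(1)] by (rule mult_left_mono) simp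
      with i(2) show ?thesis by simp
    qed
    note le = this
    have "wsum d n C \<le> wsum d n (\<Union>l\<in>I. V l \<inter> C)" using I(2) by (intro wsum_mono) auto
    also have "\<dots> \<le> (\<Sum>l\<in>I. wsum d n (V l \<inter> C))" using I(1) by (rule wsum_UN_le)
    also have "\<dots> \<le> (\<Sum>l\<in>I. (t l / \<rho>) powr d * m)" by (intro sum_mono le)
    also have "\<dots> = (\<Sum>l\<in>I. t l powr d) / \<rho> powr d * m"
      using t(1) rho_pos by (simp add: powr_divide sum_divide_distrib sum_distrib_right less_imp_le)
    also have "\<dots> \<le> 1 / 2 * m"
    proof (intro mult_right_mono)
      show "(\<Sum>l\<in>I. t l powr d) / \<rho> powr d \<le> 1 / 2" using t(3) rho_pos by (simp add: field_simps)
      show "0 \<le> m" using i wsum_nonneg by simp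
    qed
    finally show ?thesis using i by auto
  qed
  then obtain n where "wsum d n C < 1"
    using halving_imp_small[of "\<lambda>n. wsum d n C" p 1] wsum_nonneg by auto
  then show ?thesis using wsum_mono[OF model_subset, of d n] by (meson le_less_trans)
qed

text \<open>Covers of the models are pulled back to the level-1 clones by inverse clone maps, which
  contract by \<open>1 / r k\<close>. So the mesh shrinks at least by \<open>1 / rmin\<close>, while
  the weights accumulate as in \<open>wsum\<close>.\<close>

lemma hausdorff_pre_model_le:
  assumes "0 \<le> d"
  shows "hausdorff_pre d (\<Delta> / rmin ^ n) (A j) \<le> ennreal (max 1 (\<Delta> powr d) * wsum d n (A j))"
proof (induction n arbitrary: j)
  case 0
  have b: "bounded (A j)" using bounded_subset[OF compact_imp_bounded[OF compact] model_subset] .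
  have diam: "diameter (A j) \<le> \<Delta>"
    using dist_le_Delta model_subset[of j] Delta_pos by (intro diameter_le_if_dist_le) auto
  let ?U = "\<lambda>i::nat. if i = 0 then A j else {}"
  have "?U \<in> hausdorff_covers \<Delta> (A j)"
    using b diam Delta_pos by (auto simp: hausdorff_covers_def)
  then have "hausdorff_pre d \<Delta> (A j) \<le> (\<Sum>i. ennreal (hausdorff_gauge d (?U i)))"
    unfolding hausdorff_pre_def by (rule INF_lower)
  also have "\<dots> = (\<Sum>i\<in>{0}. ennreal (hausdorff_gauge d (?U i)))"
    by (intro suminf_finite) (auto simp: hausdorff_gauge_def)
  also have "\<dots> \<le> ennreal (max 1 (\<Delta> powr d))"
    using assms diam diameter_ge_0[OF b]
    by (auto simp: hausdorff_gauge_def le_max_iff_disj intro!: ennreal_leI powr_mono2)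
  finally show ?case using model_ne by simp
next
  case (Suc n)
  let ?e = "\<Delta> / rmin ^ n" and ?e' = "\<Delta> / rmin ^ Suc n" and ?g = "max 1 (\<Delta> powr d)"
  have e': "0 < ?e'" using Delta_pos rmin_gt_1 by simp
  have clone: "hausdorff_pre d ?e' (E k) \<le> ennreal (?g * ((1 / r k) powr d * wsum d n (A (ty k))))" for k
  proof -
    let ?h = "inv_into (E k) (\<tau> k)"
    have inj: "inj_on (\<tau> k) (E k)"
      using dist_tau[of _ k] r_pos[of k] by (auto simp: inj_on_def) (metis dist_eq_0_iff mult_eq_0_iff less_irrefl)
    have "hausdorff_pre d (1 / r k * ?e) (?h ` A (ty k)) \<le> ennreal ((1 / r k) powr d) * hausdorff_pre d ?e (A (ty k))"
    proof (rule lipschitz_image_pre)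
      fix x y assume "x \<in> A (ty k)" "y \<in> A (ty k)"
      then have "?h x \<in> E k" "?h y \<in> E k" "\<tau> k (?h x) = x" "\<tau> k (?h y) = y"
        using image_clone[of k] by (auto simp: inv_into_into f_inv_into_f)
      then show "dist (?h x) (?h y) \<le> 1 / r k * dist x y"
        using dist_tau[of "?h x" k "?h y"] r_pos[of k] by simp
    qed (use r_pos assms in auto)
    also have "?h ` A (ty k) = E k" using inj by (simp add: image_clone[symmetric])
    finally have le: "hausdorff_pre d (1 / r k * ?e) (E k) \<le> ennreal ((1 / r k) powr d) * hausdorff_pre d ?e (A (ty k))" .
    have "1 / r k * ?e \<le> 1 / rmin * ?e"
      using r_ge[of k] rmin_gt_1 Delta_pos by (intro mult_right_mono divide_left_mono) auto
    then have "hausdorff_pre d ?e' (E k) \<le> hausdorff_pre d (1 / r k * ?e) (E k)"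
      by (intro hausdorff_pre_antimono) simp
    also note le
    also have "ennreal ((1 / r k) powr d) * hausdorff_pre d ?e (A (ty k))
        \<le> ennreal ((1 / r k) powr d) * ennreal (?g * wsum d n (A (ty k)))"
      by (intro mult_left_mono Suc) simp
    also have "\<dots> = ennreal (?g * ((1 / r k) powr d * wsum d n (A (ty k))))"
      by (subst ennreal_mult''[symmetric]) (auto simp: mult_ac wsum_nonneg le_max_iff_disj intro!: mult_nonneg_nonneg)
    finally show ?thesis .
  qed
  have "A j = (\<Union>k\<in>{k. E k \<subseteq> A j}. E k)"
    using in_clone model_subset clone_subset_model by blast
  then have "hausdorff_pre d ?e' (A j) = hausdorff_pre d ?e' (\<Union>k\<in>{k. E k \<subseteq> A j}. E k)" by simp
  also have "\<dots> \<le> (\<Sum>k | E k \<subseteq> A j. hausdorff_pre d ?e' (E k))"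
    using e' by (intro hausdorff_pre_UN_le) auto
  also have "\<dots> \<le> (\<Sum>k | E k \<subseteq> A j. ennreal (?g * ((1 / r k) powr d * wsum d n (A (ty k)))))"
    by (intro sum_mono clone)
  also have "\<dots> = ennreal (\<Sum>k | E k \<subseteq> A j. ?g * ((1 / r k) powr d * wsum d n (A (ty k))))"
    by (intro sum_ennreal) (auto intro!: mult_nonneg_nonneg wsum_nonneg)
  also have "\<dots> = ennreal (?g * wsum d (Suc n) (A j))"
    unfolding wsum_model_Suc by (simp add: sum_distrib_left)
  finally show ?case .
qed

lemma hausdorff_outer_model_le:
  assumes "0 \<le> d" and b: "\<And>N. \<exists>n\<ge>N. wsum d n (A j) \<le> b"
  shows "hausdorff_outer d (A j) \<le> ennreal (max 1 (\<Delta> powr d) * b)"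
  unfolding hausdorff_outer_def
proof (rule SUP_least)
  fix \<epsilon> :: real assume e: "\<epsilon> \<in> {0<..}"
  obtain N where N: "\<Delta> / \<epsilon> < rmin ^ N" using real_arch_pow[OF rmin_gt_1] by blast
  obtain n where n: "n \<ge> N" "wsum d n (A j) \<le> b" using b by blast
  have "rmin ^ N \<le> rmin ^ n" using n(1) rmin_gt_1 by (intro power_increasing) auto
  with N have "\<Delta> / \<epsilon> < rmin ^ n" by (rule less_le_trans)
  then have "\<Delta> / rmin ^ n \<le> \<epsilon>" using e rmin_gt_1 by (simp add: divide_simps mult.commute)
  then have "hausdorff_pre d \<epsilon> (A j) \<le> hausdorff_pre d (\<Delta> / rmin ^ n) (A j)"
    by (rule hausdorff_pre_antimono)
  also have "\<dots> \<le> ennreal (max 1 (\<Delta> powr d) * wsum d n (A j))"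
    by (rule hausdorff_pre_model_le[OF assms(1)])
  also have "\<dots> \<le> ennreal (max 1 (\<Delta> powr d) * b)"
    using n(2) by (intro ennreal_leI mult_left_mono) auto
  finally show "hausdorff_pre d \<epsilon> (A j) \<le> ennreal (max 1 (\<Delta> powr d) * b)" .
qed

lemma wsum_less_1_bound:
  assumes "\<forall>j. wsum d n (A j) < 1"
  obtains a where "0 \<le> a" "a < 1" "\<And>j. wsum d n (A j) \<le> a" "0 < n"
proof
  let ?a = "Max (range (\<lambda>j. wsum d n (A j)))"
  show le: "wsum d n (A j) \<le> ?a" for j by simp
  show "0 \<le> ?a" using wsum_nonneg le order_trans by blast
  have "?a \<in> range (\<lambda>j. wsum d n (A j))" by (intro Max_in) auto
  then show "?a < 1" using assms by auto
  show "0 < n" using assms model_ne by (cases n) auto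
qed

lemma wsum_less_1_imp_null:
  assumes d: "0 \<le> d" and n: "\<forall>j. wsum d n (A j) < 1"
  shows "hausdorff_outer d C = 0"
proof -
  obtain a where a: "0 \<le> a" "a < 1" "\<And>j. wsum d n (A j) \<le> a" "0 < n"
    using wsum_less_1_bound[OF n] by blast
  have "hausdorff_outer d (A j) \<le> 0 + ennreal e" if e: "0 < e" for j and e :: real
  proof -
    let ?g = "max 1 (\<Delta> powr d)"
    have g: "0 < ?g" by simp
    have "(\<lambda>l. a ^ l) \<longlonglongrightarrow> 0" using a by (intro LIMSEQ_power_zero) simp
    moreover have "0 < e / ?g" using e g by simp
    ultimately have "\<forall>\<^sub>F l in sequentially. a ^ l < e / ?g" by (rule order_tendstoD(2))
    then obtain L where L: "\<And>l. l \<ge> L \<Longrightarrow> a ^ l < e / ?g" by (auto simp: eventually_sequentially)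
    have "\<exists>m\<ge>N. wsum d m (A j) \<le> e / ?g" for N
    proof (intro exI conjI)
      \<comment> \<open>The level has to be a multiple of \<open>n\<close> for the power bound, at
        least \<open>N\<close> for a fine mesh, and its multiplier at least \<open>L\<close> for
        smallness.\<close>
      have "max N L * 1 \<le> max N L * n" using a(4) by (intro mult_left_mono) auto
      then show "N \<le> max N L * n" by simp
      show "wsum d (max N L * n) (A j) \<le> e / ?g"
        using wsum_power_le[OF a(3,1), of "max N L" j] L[of "max N L"] by simp
    qed
    then have "hausdorff_outer d (A j) \<le> ennreal (?g * (e / ?g))" by (rule hausdorff_outer_model_le[OF d])
    then show ?thesis using g by simp
  qed
  then have "hausdorff_outer d (A j) \<le> 0" for j by (rule ennreal_le_epsilon)
  then show ?thesis
    using hausdorff_outer_UN_le[of UNIV d A] UN_models by simp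
qed

section \<open>The critical exponent\<close>

definition \<delta> :: real where "\<delta> = Inf {s. 0 \<le> s \<and> hausdorff_outer s C = 0}"

lemma null_exponents_ne: "{s. 0 \<le> s \<and> hausdorff_outer s C = 0} \<noteq> {}"
proof -
  let ?N = "real CARD('m)"
  \<comment> \<open>This exponent gives every level-1 clone weight at most
    \<open>1 / (?N + 1)\<close>; there are only \<open>?N\<close> of them.\<close>
  define d where "d = log rmin (?N + 1)"
  have d: "0 \<le> d" using rmin_gt_1 by (simp add: d_def)
  have p: "rmin powr d = ?N + 1" using rmin_gt_1 by (simp add: d_def)
  have "wsum d 1 (A j) < 1" for j
  proof -
    have le: "(1 / r k) powr d \<le> 1 / (?N + 1)" for k
    proof -
      have "(1 / r k) powr d \<le> (1 / rmin) powr d"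
        using r_ge[of k] rmin_gt_1 d by (intro powr_mono2 divide_left_mono) auto
      also have "\<dots> = 1 / (?N + 1)" using rmin_gt_1 p by (simp add: powr_divide)
      finally show ?thesis .
    qed
    have "wsum d 1 (A j) \<le> (\<Sum>k\<in>(UNIV::'m set). 1 / (?N + 1) * 1)"
      unfolding One_nat_def wsum.simps by (intro sum_mono mult_mono le) auto
    also have "\<dots> < 1" by (simp add: field_simps)
    finally show ?thesis .
  qed
  then show ?thesis using wsum_less_1_imp_null[OF d] d by blast
qed

lemma bdd_below_null_exponents: "bdd_below {s. 0 \<le> s \<and> hausdorff_outer s C = 0}"
  by (auto intro: bdd_belowI)

lemma delta_nonneg: "0 \<le> \<delta>"
  unfolding \<delta>_def using null_exponents_ne by (intro cInf_greatest) auto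

lemma hausdorff_dim_eq: "hausdorff_dim C = ennreal \<delta>"
  unfolding hausdorff_dim_def \<delta>_def using null_exponents_ne by (intro INF_ennreal_eq_Inf) auto

lemma outer_delta_pos: "hausdorff_outer \<delta> C \<noteq> 0"
proof
  assume null: "hausdorff_outer \<delta> C = 0"
  then have pos: "0 < \<delta>"
    using hausdorff_outer_0_ge_1[OF C_ne] delta_nonneg by (cases "\<delta> = 0") auto
  obtain n where n: "\<forall>j. wsum \<delta> n (A j) < 1" using null_imp_wsum_less_1[OF pos null] by blast
  have "\<forall>\<^sub>F d in at_left \<delta>. wsum d n (A j) < 1" for j
    using isCont_wsum[where n = n and V = "A j" and d = \<delta>] n
    by (intro order_tendstoD(2)[OF tendsto_within_subset[OF _ subset_UNIV]]) (auto simp: isCont_def)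
  then have "\<forall>\<^sub>F d in at_left \<delta>. \<forall>j. wsum d n (A j) < 1" by (rule eventually_all_finite)
  moreover have "\<forall>\<^sub>F d in at_left \<delta>. d \<in> {0<..<\<delta>}"
    using pos by (rule eventually_at_left_real)
  ultimately have "\<forall>\<^sub>F d in at_left \<delta>. (\<forall>j. wsum d n (A j) < 1) \<and> d \<in> {0<..<\<delta>}"
    by (rule eventually_conj)
  then obtain d where d: "\<forall>j. wsum d n (A j) < 1" "0 < d" "d < \<delta>"
    using eventually_happens'[OF trivial_limit_at_left_real] by (metis (no_types, lifting) greaterThanLessThan_iff)
  then have "hausdorff_outer d C = 0" using wsum_less_1_imp_null[of d n] by simp
  then have "\<delta> \<le> d" unfolding \<delta>_def using d(2) by (intro cInf_lower bdd_below_null_exponents) simp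
  with d(3) show False by simp
qed

lemma wsum_above_delta:
  assumes "\<delta> < d"
  shows "\<exists>n. \<forall>j. wsum d n (A j) < 1"
proof -
  obtain s where s: "0 \<le> s" "hausdorff_outer s C = 0" "s < d"
    using cInf_lessD[OF null_exponents_ne, of d] assms unfolding \<delta>_def by auto
  have "s \<noteq> 0" using s(2) hausdorff_outer_0_ge_1[OF C_ne] by auto
  then obtain n where "\<forall>j. wsum s n (A j) < 1" using null_imp_wsum_less_1[of s] s by auto
  then show ?thesis using wsum_antimono_exponent[of s d n] s(3) by (meson less_imp_le le_less_trans)
qed

section \<open>Consequences of irreducibility\<close>

lemma clone_matrix_pos:
  assumes "0 < clone_matrix A E \<tau> r d $ i $ j"
  obtains k where "ty k = i" "E k \<subseteq> A j"
proof -
  obtain k where k: "\<tau> k ` E k = A i" "E k \<subseteq> A j"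
  proof (rule ccontr)
    assume "\<not> thesis"
    then have "{k. \<tau> k ` E k = A i \<and> E k \<subseteq> A j} = {}" using that by blast
    then have "clone_matrix A E \<tau> r d $ i $ j = (\<Sum>k\<in>{}. (1 / r k) powr d)"
      unfolding clone_matrix_def by (simp only: vec_lambda_beta)
    with assms show False by simp
  qed
  have "A (ty k) = A i" using k(1) image_clone by simp
  then have "ty k = i" using model_ne[of i] model_eq by blast
  with k(2) show thesis using that by blast
qed

lemma clone_matrix_power_Suc_pos:
  fixes M P :: "real ^ 'n ^ 'n"
  assumes "\<And>i j. 0 \<le> M $ i $ j" "0 < (M ** P) $ i $ j"
  obtains l where "0 < M $ i $ l" "0 < P $ l $ j"
proof -
  have "0 < (\<Sum>l\<in>UNIV. M $ i $ l * P $ l $ j)" using assms(2) by (simp add: matrix_matrix_mult_def)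
  then obtain l where "0 < M $ i $ l * P $ l $ j" by (meson not_less sum_nonpos)
  then have "0 < M $ i $ l" "0 < P $ l $ j" using assms(1)[of i l] by (auto simp: zero_less_mult_iff)
  then show thesis by (rule that)
qed

end

locale irreducible_cantor_set = multi_model_cantor_set +
  assumes irreducible: "has_irreducible_matrix A E \<tau> r"
begin

text \<open>A positive entry \<open>(i, j)\<close> of a power of the matrix is a chain of clones and
  clone maps leading from \<open>A j\<close> to \<open>A i\<close>; the property travels along
  it.\<close>

lemma irreducible_induct:
  assumes j: "P j" and step: "\<And>k j. E k \<subseteq> A j \<Longrightarrow> P j \<Longrightarrow> P (ty k)"
  shows "P i"
proof -
  obtain d where "irreducible_matrix (clone_matrix A E \<tau> r d)"
    using irreducible by (auto simp: has_irreducible_matrix_def)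
  then obtain p where nn: "\<And>i j. 0 \<le> clone_matrix A E \<tau> r d $ i $ j"
    and pos: "\<And>i j. 0 < (((**) (clone_matrix A E \<tau> r d) ^^ p) (mat 1)) $ i $ j"
    by (auto simp: irreducible_matrix_def)
  let ?M = "clone_matrix A E \<tau> r d"
  have "0 < (((**) ?M ^^ n) (mat 1)) $ i $ j \<Longrightarrow> P i" for n i
  proof (induction n arbitrary: i)
    case 0
    then have "i = j" by (simp add: mat_def split: if_splits)
    then show ?case using j by simp
  next
    case (Suc n)
    then obtain l where l: "0 < ?M $ i $ l" "0 < (((**) ?M ^^ n) (mat 1)) $ l $ j"
      using clone_matrix_power_Suc_pos[OF nn, of "((**) ?M ^^ n) (mat 1)" i j] by auto
    obtain k where "ty k = i" "E k \<subseteq> A l" using clone_matrix_pos[OF l(1)] .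
    then show ?case using step[of k l] Suc.IH[OF l(2)] by simp
  qed
  then show ?thesis using pos by blast
qed

text \<open>After \<open>p\<close> steps each model contains a scaled-down copy of every other one,
  of scale factor at most \<open>rmax ^ p\<close>. The number \<open>p\<close> is read off at one
  exponent but serves all exponents, because only the chain of clones matters; this permits a limit
  in \<open>d\<close> later.\<close>

lemma irreducible_wsum:
  obtains p where "0 < p"
    "\<And>d n i j. 0 \<le> d \<Longrightarrow> ((1 / rmax) powr d) ^ p * wsum d n (A i) \<le> wsum d (n + p) (A j)"
proof -
  obtain d0 where "irreducible_matrix (clone_matrix A E \<tau> r d0)"
    using irreducible by (auto simp: has_irreducible_matrix_def)
  then obtain p where nn: "\<And>i j. 0 \<le> clone_matrix A E \<tau> r d0 $ i $ j" and p: "0 < p"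
    and pos: "\<And>i j. 0 < (((**) (clone_matrix A E \<tau> r d0) ^^ p) (mat 1)) $ i $ j"
    by (auto simp: irreducible_matrix_def)
  let ?M = "clone_matrix A E \<tau> r d0"
  have "((1 / rmax) powr d) ^ m * wsum d n (A i) \<le> wsum d (n + m) (A j)"
    if "0 \<le> d" "0 < (((**) ?M ^^ m) (mat 1)) $ i $ j" for d m n i j
    using that(2)
  proof (induction m arbitrary: n i)
    case 0
    then have "i = j" by (simp add: mat_def split: if_splits)
    then show ?case by simp
  next
    case (Suc m)
    then obtain l where l: "0 < ?M $ i $ l" "0 < (((**) ?M ^^ m) (mat 1)) $ l $ j"
      using clone_matrix_power_Suc_pos[OF nn, of "((**) ?M ^^ m) (mat 1)" i j] by auto
    obtain k where k: "ty k = i" "E k \<subseteq> A l" using clone_matrix_pos[OF l(1)] .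
    have "(1 / rmax) powr d * wsum d n (A i) \<le> (1 / r k) powr d * wsum d n (A (ty k))"
      using r_le[of k] r_pos[of k] rmax_gt_1 k(1) that(1)
      by (intro mult_mono wsum_nonneg powr_mono2 divide_left_mono) auto
    also have "\<dots> \<le> wsum d (Suc n) (A l)"
      unfolding wsum_model_Suc using k(2)
      by (intro member_le_sum[of k "{k. E k \<subseteq> A l}" "\<lambda>k. (1 / r k) powr d * wsum d n (A (ty k))"])
        (auto intro!: mult_nonneg_nonneg wsum_nonneg)
    finally have "((1 / rmax) powr d) ^ m * ((1 / rmax) powr d * wsum d n (A i))
        \<le> ((1 / rmax) powr d) ^ m * wsum d (Suc n) (A l)" by (intro mult_left_mono) auto
    also have "\<dots> \<le> wsum d (Suc n + m) (A j)" by (rule Suc.IH[OF l(2)])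
    finally show ?case by (simp add: mult_ac)
  qed
  then show thesis using that[OF p] pos by blast
qed

text \<open>Above \<open>\<delta>\<close> the counts decay along multiples of some level. A count
  too large for one model would, by irreducibility, push the counts of all models to at least 1 at
  one level and hence at all its multiples. The resulting bound is uniform in \<open>n\<close> and
  survives the limit of \<open>d\<close> to \<open>\<delta>\<close> from the right.\<close>

lemma outer_delta_model_finite: "hausdorff_outer \<delta> (A j) < top"
proof -
  obtain p where p: "0 < p"
    "\<And>d n i j. 0 \<le> d \<Longrightarrow> ((1 / rmax) powr d) ^ p * wsum d n (A i) \<le> wsum d (n + p) (A j)"
    using irreducible_wsum by blast
  have above: "((1 / rmax) powr d) ^ p * wsum d n (A i) \<le> 1" if d: "\<delta> < d" for d n i
  proof (rule ccontr)
    assume "\<not> ?thesis"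
    then have "1 \<le> wsum d (n + p) (A j)" for j
      using p(2)[of d n i j] d delta_nonneg by linarith
    then have ge: "1 \<le> wsum d (m * (n + p)) (A j)" for m j by (rule wsum_power_ge_1)
    obtain m where m: "\<forall>j. wsum d m (A j) < 1" using wsum_above_delta[OF d] by blast
    obtain a where a: "0 \<le> a" "a < 1" "\<And>j. wsum d m (A j) \<le> a"
      using wsum_less_1_bound[OF m] by blast
    \<comment> \<open>The contradiction arises at a common multiple of the two levels.\<close>
    have "wsum d ((n + p) * m) (A j) \<le> a ^ (n + p)" by (rule wsum_power_le[OF a(3,1)])
    also have "\<dots> < 1" using power_decreasing[of 1 "n + p" a] a(1,2) p(1) by simp
    finally show False using ge[of m j] by (simp add: mult.commute)
  qed
  have le: "((1 / rmax) powr \<delta>) ^ p * wsum \<delta> n (A j) \<le> 1" for n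
  proof (rule tendsto_upperbound)
    have "isCont (\<lambda>d. ((1 / rmax) powr d) ^ p * wsum d n (A j)) \<delta>"
      using rmax_gt_1 by (intro continuous_intros isCont_wsum) auto
    then show "((\<lambda>d. ((1 / rmax) powr d) ^ p * wsum d n (A j)) \<longlongrightarrow> ((1 / rmax) powr \<delta>) ^ p * wsum \<delta> n (A j)) (at_right \<delta>)"
      unfolding isCont_def by (rule tendsto_within_subset) simp
    show "\<forall>\<^sub>F d in at_right \<delta>. ((1 / rmax) powr d) ^ p * wsum d n (A j) \<le> 1"
      using eventually_at_right_less[of \<delta>] by eventually_elim (rule above)
  qed simp
  have c: "0 < ((1 / rmax) powr \<delta>) ^ p" using rmax_gt_1 by simp
  have "wsum \<delta> n (A j) \<le> 1 / ((1 / rmax) powr \<delta>) ^ p" for n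
    using le[of n] c by (simp add: pos_le_divide_eq mult.commute)
  then have "hausdorff_outer \<delta> (A j) \<le> ennreal (max 1 (\<Delta> powr \<delta>) * (1 / ((1 / rmax) powr \<delta>) ^ p))"
    by (intro hausdorff_outer_model_le delta_nonneg) blast
  then show ?thesis by (simp add: le_less_trans)
qed

lemma outer_delta_finite: "hausdorff_outer \<delta> C < top"
proof -
  have "hausdorff_outer \<delta> C \<le> (\<Sum>j\<in>UNIV. hausdorff_outer \<delta> (A j))"
    using hausdorff_outer_UN_le[of UNIV \<delta> A] UN_models by simp
  also have "\<dots> < top" using outer_delta_model_finite by (simp add: less_top)
  finally show ?thesis .
qed

text \<open>A clone inside a null model is null, and its clone map expands it onto the model of its
  type; irreducibility reaches all models in this way.\<close>

lemma model_null_imp_null: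
  assumes s: "0 \<le> s" and "hausdorff_outer s (A j) = 0"
  shows "hausdorff_outer s C = 0"
proof -
  have "hausdorff_outer s (A i) = 0" for i
  proof (rule irreducible_induct[of "\<lambda>i. hausdorff_outer s (A i) = 0", OF assms(2)])
    fix k j assume "E k \<subseteq> A j" "hausdorff_outer s (A j) = 0"
    then have "hausdorff_outer s (E k) = 0" using hausdorff_outer_mono[of "E k" "A j" s] by simp
    moreover have "hausdorff_outer s (\<tau> k ` E k) = ennreal (r k powr s) * hausdorff_outer s (E k)"
      using r_pos s dist_tau by (intro similarity_image_outer) auto
    ultimately show "hausdorff_outer s (A (ty k)) = 0" by (simp add: image_clone)
  qed
  then show ?thesis using hausdorff_outer_UN_le[of UNIV s A] UN_models by simp
qed

lemma clone_null_imp_null: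
  assumes s: "0 \<le> s" and x: "x \<in> C" and "hausdorff_outer s (clone n x) = 0"
  shows "hausdorff_outer s C = 0"
proof -
  have "hausdorff_outer s ((T ^^ n) ` clone n x) = 0"
    using outer_T_funpow[OF s order_refl] assms(3) by simp
  moreover have "(T ^^ n) ` clone n x = C \<or> (\<exists>j. (T ^^ n) ` clone n x = A j)"
    using T_funpow_clone[OF x, of n] by blast
  ultimately show ?thesis using model_null_imp_null[OF s] by metis
qed

end

section \<open>Densities of a bilipschitz embedding\<close>

context multi_model_cantor_set
begin

lemma small_clone:
  assumes "x \<in> C" "0 < e"
  obtains N where "\<And>n y. N \<le> n \<Longrightarrow> y \<in> clone n x \<Longrightarrow> dist x y < e"
proof -
  obtain N where N: "\<Delta> / e < rmin ^ N" using real_arch_pow[OF rmin_gt_1] by blast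
  have "dist x y < e" if n: "N \<le> n" and y: "y \<in> clone n x" for n y
  proof -
    have "rmin ^ N \<le> rmin ^ n" using n rmin_gt_1 by (intro power_increasing) auto
    also have "\<dots> \<le> scl n x" by (rule scl_ge_power)
    finally have "\<Delta> / e < scl n x" using N by simp
    then have "\<Delta> / scl n x < e" using assms(2) scl_pos[of n x] by (simp add: field_simps)
    then show ?thesis using dist_clone_le[OF clone_self[OF assms(1)] y] by simp
  qed
  then show thesis by (rule that)
qed

end

locale bilipschitz_clopen_embedding =
  X: irreducible_cantor_set C A E \<tau> r + Y: irreducible_cantor_set C' A' E' \<tau>' r'
  for C :: "'a::metric_space set" and A :: "'n::finite \<Rightarrow> 'a set" and E :: "'m::finite \<Rightarrow> 'a set"
    and \<tau> r
    and C' :: "'b::metric_space set" and A' :: "'p::finite \<Rightarrow> 'b set" and E' :: "'q::finite \<Rightarrow> 'b set"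
    and \<tau>' r' +
  fixes f :: "'a \<Rightarrow> 'b" and K :: real
  assumes bilip: "bilipschitz_on K C f" and clopen: "clopen_in C' (f ` C)"
begin

lemma K_pos: "0 < K" using bilip by (simp add: bilipschitz_on_def)

lemma f_le: "x \<in> C \<Longrightarrow> y \<in> C \<Longrightarrow> dist (f x) (f y) \<le> K * dist x y"
  using bilip by (simp add: bilipschitz_on_def)

lemma f_ge: "x \<in> C \<Longrightarrow> y \<in> C \<Longrightarrow> dist x y \<le> K * dist (f x) (f y)"
  using bilip K_pos by (simp add: bilipschitz_on_def field_simps)

lemma f_inj: "inj_on f C"
proof (rule inj_onI)
  fix x y assume "x \<in> C" "y \<in> C" "f x = f y"
  then show "x = y" using f_ge[of x y] by simp
qed

lemma f_in: "x \<in> C \<Longrightarrow> f x \<in> C'"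
  using clopen closedin_subset[of "top_of_set C'" "f ` C"] by (auto simp: clopen_in_def)

lemma outer_f_le: "0 \<le> s \<Longrightarrow> S \<subseteq> C \<Longrightarrow> hausdorff_outer s (f ` S) \<le> ennreal (K powr s) * hausdorff_outer s S"
  using f_le K_pos by (intro lipschitz_image_outer) auto

lemma outer_f_ge:
  assumes "0 \<le> s" "S \<subseteq> C"
  shows "hausdorff_outer s S \<le> ennreal (K powr s) * hausdorff_outer s (f ` S)"
proof -
  let ?h = "inv_into C f"
  have h: "?h (f x) = x" if "x \<in> S" for x using that assms(2) f_inj by (auto intro!: inv_into_f_f)
  have "hausdorff_outer s (?h ` f ` S) \<le> ennreal (K powr s) * hausdorff_outer s (f ` S)"
  proof (rule lipschitz_image_outer[OF K_pos _ assms(1)])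
    fix x y assume "x \<in> f ` S" "y \<in> f ` S"
    then obtain a b where "a \<in> S" "b \<in> S" "x = f a" "y = f b" by blast
    then show "dist (?h x) (?h y) \<le> K * dist x y" using h f_ge[of a b] assms(2) by auto
  qed
  moreover have "?h ` f ` S = S" using h by force
  ultimately show ?thesis by simp
qed

text \<open>The image is open in \<open>C'\<close> and so contains a whole clone of
  \<open>C'\<close>; by irreducibility a single null clone makes all of \<open>C'\<close>
  null.\<close>

lemma null_iff:
  assumes s: "0 \<le> s"
  shows "hausdorff_outer s C = 0 \<longleftrightarrow> hausdorff_outer s C' = 0"
proof
  assume "hausdorff_outer s C = 0"
  then have null: "hausdorff_outer s (f ` C) = 0" using outer_f_le[OF s order_refl] by simp
  obtain x where x: "x \<in> C" using X.C_ne by blast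
  obtain e where e: "0 < e" "gap e C' (f ` C)" by (rule clopen_in_imp_gap[OF Y.compact clopen])
  obtain N where N: "\<And>n y. N \<le> n \<Longrightarrow> y \<in> Y.clone n (f x) \<Longrightarrow> dist (f x) y < e"
    using Y.small_clone[OF f_in[OF x] e(1)] by blast
  have "Y.clone N (f x) \<subseteq> f ` C" 
  proof
    fix y assume y: "y \<in> Y.clone N (f x)"
    then have "y \<in> C'" "dist (f x) y < e" using N[of N y] Y.clone_le by auto
    then show "y \<in> f ` C" using e(2) x unfolding gap_def by blast
  qed
  then have "hausdorff_outer s (Y.clone N (f x)) = 0" using null hausdorff_outer_mono by (metis le_zero_eq)
  then show "hausdorff_outer s C' = 0" by (rule Y.clone_null_imp_null[OF s f_in[OF x]])
next
  assume "hausdorff_outer s C' = 0"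
  then have "hausdorff_outer s (f ` C) = 0" using f_in hausdorff_outer_mono by (metis image_subsetI le_zero_eq)
  then show "hausdorff_outer s C = 0" using outer_f_ge[OF s order_refl] by simp
qed

lemma same_exponent: "Y.\<delta> = X.\<delta>"
  unfolding X.\<delta>_def Y.\<delta>_def using null_iff by (metis (no_types, lifting))

text \<open>Polymorphic, so that one symbol serves \<open>C\<close> and \<open>C'\<close>. Subsets
  of either have finite outer measure, so nothing is lost by passing to reals.\<close>

definition \<mu> :: "'c::metric_space set \<Rightarrow> real" where "\<mu> S = enn2real (hausdorff_outer X.\<delta> S)"

lemma outer_finite: "S \<subseteq> C \<Longrightarrow> hausdorff_outer X.\<delta> S < top"
  using X.outer_delta_finite hausdorff_outer_mono le_less_trans by blast

lemma outer_finite': "S \<subseteq> C' \<Longrightarrow> hausdorff_outer X.\<delta> S < top"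
  using Y.outer_delta_finite hausdorff_outer_mono le_less_trans unfolding same_exponent by blast

lemma outer_eq: "S \<subseteq> C \<Longrightarrow> hausdorff_outer X.\<delta> S = ennreal (\<mu> S)"
  and outer_eq': "S' \<subseteq> C' \<Longrightarrow> hausdorff_outer X.\<delta> S' = ennreal (\<mu> S')"
  using outer_finite outer_finite' by (auto simp: \<mu>_def)

lemma mu_nonneg: "0 \<le> \<mu> S" by (simp add: \<mu>_def)

lemma mu_empty [simp]: "\<mu> {} = 0" by (simp add: \<mu>_def hausdorff_outer_empty)

lemma mu_clone_pos: "x \<in> C \<Longrightarrow> 0 < \<mu> (X.clone n x)"
  using X.clone_null_imp_null[OF X.delta_nonneg] X.outer_delta_pos outer_eq[OF X.clone_le[of n x]] mu_nonneg
  by (metis ennreal_0 less_eq_real_def)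

lemma mu_f_le: "S \<subseteq> C \<Longrightarrow> \<mu> (f ` S) \<le> K powr X.\<delta> * \<mu> S"
  and mu_f_ge: "S \<subseteq> C \<Longrightarrow> \<mu> S \<le> K powr X.\<delta> * \<mu> (f ` S)"
proof -
  assume S: "S \<subseteq> C"
  then have S': "f ` S \<subseteq> C'" using f_in by auto
  show "\<mu> (f ` S) \<le> K powr X.\<delta> * \<mu> S"
    using outer_f_le[OF X.delta_nonneg S] outer_eq[OF S] outer_eq'[OF S']
    by (simp add: ennreal_mult[symmetric] mu_nonneg ennreal_le_iff)
  show "\<mu> S \<le> K powr X.\<delta> * \<mu> (f ` S)"
    using outer_f_ge[OF X.delta_nonneg S] outer_eq[OF S] outer_eq'[OF S']
    by (simp add: ennreal_mult[symmetric] mu_nonneg ennreal_le_iff)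
qed

lemma mu_f_clone_pos: "x \<in> C \<Longrightarrow> 0 < \<mu> (f ` X.clone n x)"
  using mu_f_ge[OF X.clone_le[of n x]] mu_clone_pos[of x n] mu_nonneg[of "f ` X.clone n x"]
  by (cases "\<mu> (f ` X.clone n x) = 0") auto

lemma mu_T_funpow: "S \<subseteq> X.clone n x \<Longrightarrow> \<mu> ((X.T ^^ n) ` S) = X.scl n x powr X.\<delta> * \<mu> S"
  using X.outer_T_funpow[OF X.delta_nonneg] by (simp add: \<mu>_def enn2real_mult)

lemma mu_T_funpow': "S \<subseteq> Y.clone n x \<Longrightarrow> \<mu> ((Y.T ^^ n) ` S) = Y.scl n x powr X.\<delta> * \<mu> S"
  using Y.outer_T_funpow[OF X.delta_nonneg] by (simp add: \<mu>_def enn2real_mult)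

section \<open>Zooming the images of clones\<close>

definition \<epsilon> :: real where "\<epsilon> = (SOME e. 0 < e \<and> gap e C' (f ` C))"

lemma eps_pos: "0 < \<epsilon>" and gap_image: "gap \<epsilon> C' (f ` C)"
proof -
  have "\<exists>e>0. gap e C' (f ` C)" using clopen_in_imp_gap[OF Y.compact clopen] by blast
  from someI_ex[OF this, folded \<epsilon>_def] show "0 < \<epsilon>" "gap \<epsilon> C' (f ` C)" by auto
qed

text \<open>A nearby point must lie in the image of \<open>C\<close> before it can be pulled back,
  which the gap \<open>\<epsilon>\<close> of the image ensures; pulling back then costs a factor
  \<open>K\<close>.\<close>

lemma gap_f:
  assumes "gap e C S"
  shows "gap (min \<epsilon> (e / K)) C' (f ` S)"
  unfolding gap_def
proof (intro conjI ballI impI)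
  show "f ` S \<subseteq> C'" using assms f_in by (auto simp: gap_def)
  fix y z assume y: "y \<in> f ` S" and z: "z \<in> C'" and d: "dist y z < min \<epsilon> (e / K)"
  obtain a where a: "a \<in> S" "a \<in> C" "y = f a" using y assms by (auto simp: gap_def)
  have "z \<in> f ` C" using gap_image z d a(2,3) by (auto simp: gap_def)
  then obtain b where b: "b \<in> C" "z = f b" by blast
  have "dist a b \<le> K * dist y z" using f_ge[OF a(2) b(1)] a(3) b(2) by simp
  also have "\<dots> < e" using d K_pos by (simp add: field_simps)
  finally show "z \<in> f ` S" using assms a(1) b by (auto simp: gap_def)
qed

lemma f_clone_measurable: "0 \<le> s \<Longrightarrow> f ` X.clone n x \<in> sets (hausdorff_measure s C')"
proof (rule gap_imp_measurable[OF gap_f[OF X.gap_clone]])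
  show "0 < min \<epsilon> (X.\<rho> / X.scl n x / K)"
    using eps_pos divide_pos_pos[OF X.gap_clone_pos K_pos] by simp
qed

text \<open>
  The largest \<open>m\<close> for which the image of a clone lies in a single level-\<open>m\<close> clone: expanding
  that far makes the image of comparable size to \<open>C'\<close>.
\<close>

lemma zoom_level:
  assumes x: "x \<in> C"
  obtains m where "f ` X.clone n x \<subseteq> Y.clone m (f x)"
    "Y.\<rho> * X.scl n x \<le> K * X.\<Delta> * Y.scl m (f x)"
proof -
  define P where "P m \<longleftrightarrow> f ` X.clone n x \<subseteq> Y.clone m (f x)" for m
  have P0: "P 0" using X.clone_le f_in by (auto simp: P_def)
  \<comment> \<open>Without a second point in the clone its image could lie in clones of every
    level, and no last level would exist.\<close>
  obtain y where y: "y \<in> X.clone n x" "y \<noteq> x" by (rule X.clone_two_points[OF x])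
  have yC: "y \<in> C" using y(1) X.clone_le by blast
  have "0 < dist (f x) (f y)" using f_inj x yC y(2) by (simp add: inj_on_eq_iff)
  then obtain N where "\<And>n z. N \<le> n \<Longrightarrow> z \<in> Y.clone n (f x) \<Longrightarrow> dist (f x) z < dist (f x) (f y)"
    using Y.small_clone[OF f_in[OF x]] by blast
  then have "f y \<notin> Y.clone N (f x)" by blast
  then have "\<not> P N" using y(1) by (auto simp: P_def)
  then obtain m where m: "P m" "\<not> P (Suc m)" using P0 by (metis nat_induct)
  then obtain z where z: "z \<in> X.clone n x" "f z \<in> Y.clone m (f x)" "f z \<notin> Y.clone (Suc m) (f x)"
    by (auto simp: P_def)
  have zC: "z \<in> C" using z(1) X.clone_le by blast
  have fx: "f x \<in> Y.clone m (f x)" using f_in[OF x] by (rule Y.clone_self)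
  \<comment> \<open>Different next symbols mean that after \<open>m\<close> expansions the two image
    points are at least \<open>Y.\<rho>\<close> apart; this bounds the scale factor from
    below.\<close>
  have "Y.\<kappa> ((Y.T ^^ m) (f z)) \<noteq> Y.\<kappa> ((Y.T ^^ m) (f x))" using z(2,3) by (auto simp: Y.clone_Suc)
  then have "Y.\<rho> \<le> dist ((Y.T ^^ m) (f z)) ((Y.T ^^ m) (f x))"
    using Y.kappa_eqI Y.T_funpow_in f_in x zC by (meson not_less)
  also have "\<dots> = Y.scl m (f x) * dist (f z) (f x)" by (rule Y.dist_T_funpow[OF z(2) fx])
  also have "\<dots> \<le> Y.scl m (f x) * (K * (X.\<Delta> / X.scl n x))"
  proof (intro mult_left_mono)
    have "dist (f z) (f x) \<le> K * dist z x" by (rule f_le[OF zC x])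
    also have "\<dots> \<le> K * (X.\<Delta> / X.scl n x)"
      using X.dist_clone_le[OF z(1) X.clone_self[OF x]] K_pos by (intro mult_left_mono) auto
    finally show "dist (f z) (f x) \<le> K * (X.\<Delta> / X.scl n x)" .
  qed (simp add: Y.scl_pos less_imp_le)
  finally have "Y.\<rho> * X.scl n x \<le> K * X.\<Delta> * Y.scl m (f x)"
    using X.scl_pos[of n x] by (simp add: field_simps)
  with m(1) show thesis using that by (simp add: P_def)
qed

text \<open>\<open>Y.\<rho>\<close> lets a point near the zoomed image be pulled back to
  \<open>C'\<close>, and \<open>\<epsilon>\<close> then places it in the image of \<open>C\<close>.
  The last term keeps its preimage in the clone: one factor \<open>K\<close> comes from inverting
  \<open>f\<close>, the other, with \<open>X.\<Delta>\<close> and \<open>Y.\<rho>\<close>, from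
  comparing the scales in \<open>zoom_level\<close>, and \<open>X.rmax\<close> allows for passing to
  a child.\<close>

definition \<eta> :: real where
  "\<eta> = min (min Y.\<rho> \<epsilon>) (X.\<rho> * Y.\<rho> / (K * K * X.\<Delta> * X.rmax))"

lemma eta_pos: "0 < \<eta>"
  using Y.rho_pos X.rho_pos eps_pos K_pos X.Delta_pos X.rmax_gt_1 by (simp add: \<eta>_def)

text \<open>The zoomed images have a uniform gap, so only finitely many of them occur.\<close>

lemma gap_zoom:
  assumes x: "x \<in> C" and sub: "f ` X.clone n x \<subseteq> Y.clone m (f x)"
    and m: "Y.\<rho> * X.scl n x \<le> K * X.\<Delta> * Y.scl m (f x)"
    and x': "x' \<in> X.clone n x" and l: "l = n \<or> l = Suc n"
  shows "gap \<eta> C' ((Y.T ^^ m) ` f ` X.clone l x')"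
  unfolding gap_def
proof (intro conjI ballI impI)
  have cl: "X.clone l x' \<subseteq> X.clone n x"
  proof -
    have "n \<le> l" using l by linarith
    then have "X.clone l x' \<subseteq> X.clone n x'" by (rule X.clone_antimono)
    then show ?thesis unfolding X.clone_cong[OF x'] .
  qed
  show "(Y.T ^^ m) ` f ` X.clone l x' \<subseteq> C'"
    using X.clone_le f_in Y.T_funpow_in by blast
  fix u z assume u: "u \<in> (Y.T ^^ m) ` f ` X.clone l x'" and z: "z \<in> C'" and d: "dist u z < \<eta>"
  obtain a where a: "a \<in> X.clone l x'" "u = (Y.T ^^ m) (f a)" using u by blast
  have aC: "a \<in> C" using a(1) X.clone_le by blast
  have fa: "f a \<in> Y.clone m (f x)" using a(1) cl sub by blast
  obtain z' where z': "z' \<in> Y.clone m (f a)" "(Y.T ^^ m) z' = z"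
    using Y.T_funpow_onto[OF f_in[OF aC] z, of m] d a(2) by (auto simp: \<eta>_def)
  let ?R = "X.scl n x" and ?R' = "Y.scl m (f x)"
  have R: "0 < ?R" "0 < ?R'" "1 \<le> ?R'" by (auto simp: X.scl_pos Y.scl_pos Y.scl_ge_1)
  have z'C: "z' \<in> C'" using z'(1) Y.clone_le by blast
  have "z' \<in> Y.clone m (f x)" using z'(1) Y.clone_cong[OF fa] by simp
  from Y.dist_T_funpow[OF fa this] have "dist u z = ?R' * dist (f a) z'" unfolding a(2) z'(2) .
  then have d': "?R' * dist (f a) z' < \<eta>" using d by simp
  have "dist (f a) z' \<le> ?R' * dist (f a) z'" using mult_right_mono[OF R(3), of "dist (f a) z'"] by simp
  then have "dist (f a) z' < \<epsilon>" using d' by (simp add: \<eta>_def)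
  then have "z' \<in> f ` C" using gap_image aC z'C by (auto simp: gap_def)
  then obtain b where b: "b \<in> C" "z' = f b" by blast
  have scl_l: "X.scl l x' \<le> ?R * X.rmax"
  proof -
    have "X.scl n x' = ?R" by (rule X.scl_cong[OF x'])
    then show ?thesis
      using l X.r_le R(1) X.rmax_gt_1 by (auto simp: X.scl_Suc intro!: mult_left_mono)
  qed
  have "K * \<eta> \<le> X.\<rho> * Y.\<rho> / (K * X.\<Delta> * X.rmax)"
  proof -
    have "K * \<eta> \<le> K * (X.\<rho> * Y.\<rho> / (K * K * X.\<Delta> * X.rmax))"
      unfolding \<eta>_def using K_pos by (intro mult_left_mono) auto
    then show ?thesis using K_pos by (simp add: field_simps)
  qed
  also have "\<dots> \<le> X.\<rho> / (?R * X.rmax) * ?R'"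
  proof -
    let ?c = "X.\<rho> / (X.rmax * ?R * K * X.\<Delta>)"
    have "X.\<rho> * Y.\<rho> / (K * X.\<Delta> * X.rmax) = ?c * (Y.\<rho> * ?R)" using R by simp
    also have "\<dots> \<le> ?c * (K * X.\<Delta> * ?R')"
      using m K_pos X.Delta_pos X.rmax_gt_1 X.rho_pos R by (intro mult_left_mono) auto
    also have "\<dots> = X.\<rho> / (?R * X.rmax) * ?R'" using K_pos X.Delta_pos by simp
    finally show ?thesis .
  qed
  also have "\<dots> \<le> X.\<rho> / X.scl l x' * ?R'"
    using scl_l X.scl_pos[of l x'] X.rho_pos R by (intro mult_right_mono divide_left_mono) auto
  finally have bound: "K * \<eta> \<le> X.\<rho> / X.scl l x' * ?R'" .
  have "?R' * dist a b \<le> ?R' * (K * dist (f a) z')"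
    using f_ge[OF aC b(1)] b(2) R by (intro mult_left_mono) auto
  also have "\<dots> < K * \<eta>" using d' K_pos by (simp add: field_simps)
  also note bound
  finally have "?R' * dist a b < ?R' * (X.\<rho> / X.scl l x')" by (simp only: mult.commute)
  then have "dist a b < X.\<rho> / X.scl l x'" using R(2) by (rule mult_left_less_imp_less[OF _ less_imp_le])
  then have "b \<in> X.clone l x'" using X.gap_clone[of l x'] a(1) b(1) by (auto simp: gap_def)
  then show "z \<in> (Y.T ^^ m) ` f ` X.clone l x'" using z'(2) b(2) by blast
qed

section \<open>Density ratios between a clone and its children\<close>

definition dens :: "nat \<Rightarrow> 'a \<Rightarrow> real" where
  "dens n x = \<mu> (f ` X.clone n x) / \<mu> (X.clone n x)"

lemma dens_pos: "x \<in> C \<Longrightarrow> 0 < dens n x"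
  using mu_clone_pos mu_f_clone_pos by (simp add: dens_def)

lemma dens_le: "x \<in> C \<Longrightarrow> dens n x \<le> K powr X.\<delta>"
  using mu_f_le[OF X.clone_le[of n x]] mu_clone_pos[of x n] by (simp add: dens_def divide_le_eq)

text \<open>The components stand for the zoomed image of a child, the zoomed image of its parent,
  the expanded parent, and the symbol of the level-1 clone onto which the child expands.\<close>

definition ratios :: "real set" where
  "ratios = (\<lambda>(V, W, P, k). (\<mu> V / \<mu> W) * (\<mu> P / \<mu> (E k))) `
     ({V. gap \<eta> C' V} \<times> {W. gap \<eta> C' W} \<times> insert C (range A) \<times> UNIV)"

lemma finite_ratios: "finite ratios"
  unfolding ratios_def using finite_gap_sets[OF Y.compact eta_pos]
  by (intro finite_imageI finite_cartesian_product) auto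

text \<open>The images of parent and child are zoomed by the same iterate in \<open>C'\<close>, and
  parent and child themselves by the same iterate in \<open>C\<close>. Each common scale factor
  cancels in the corresponding quotient of measures.\<close>

lemma dens_ratio:
  assumes x: "x \<in> C" and x': "x' \<in> X.clone n x"
  shows "dens (Suc n) x' / dens n x \<in> ratios"
proof -
  obtain m where m: "f ` X.clone n x \<subseteq> Y.clone m (f x)"
    "Y.\<rho> * X.scl n x \<le> K * X.\<Delta> * Y.scl m (f x)"
    by (rule zoom_level[OF x])
  have x'C: "x' \<in> C" using x' X.clone_le by blast
  have sub: "X.clone (Suc n) x' \<subseteq> X.clone n x" using X.clone_cong[OF x'] by (auto simp: X.clone_Suc)
  let ?V = "(Y.T ^^ m) ` f ` X.clone (Suc n) x'" and ?W = "(Y.T ^^ m) ` f ` X.clone n x"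
  let ?P = "(X.T ^^ n) ` X.clone n x" and ?k = "X.\<kappa> ((X.T ^^ n) x')"
  have V: "gap \<eta> C' ?V" by (rule gap_zoom[OF x m x']) simp
  have W: "gap \<eta> C' ?W" by (rule gap_zoom[OF x m X.clone_self[OF x]]) simp
  have P: "?P \<in> insert C (range A)" by (rule X.T_funpow_clone[OF x])
  have k: "E ?k = (X.T ^^ n) ` X.clone (Suc n) x'" by (rule X.T_funpow_clone_Suc[OF x'C, symmetric])
  let ?a = "Y.scl m (f x) powr X.\<delta>" and ?b = "X.scl n x powr X.\<delta>"
  have ab: "0 < ?a" "0 < ?b" using Y.scl_pos[of m "f x"] X.scl_pos[of n x] by auto
  have "\<mu> ?V = ?a * \<mu> (f ` X.clone (Suc n) x')" using sub m(1) by (intro mu_T_funpow') auto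
  moreover have "\<mu> ?W = ?a * \<mu> (f ` X.clone n x)" using m(1) by (intro mu_T_funpow') auto
  moreover have "\<mu> ?P = ?b * \<mu> (X.clone n x)" by (intro mu_T_funpow) auto
  moreover have "\<mu> (E ?k) = ?b * \<mu> (X.clone (Suc n) x')" unfolding k using sub by (intro mu_T_funpow)
  ultimately have "(\<mu> ?V / \<mu> ?W) * (\<mu> ?P / \<mu> (E ?k)) = dens (Suc n) x' / dens n x"
    using ab by (simp add: dens_def)
  then show ?thesis unfolding ratios_def using V W P
    by (intro image_eqI[of _ _ "(?V, ?W, ?P, ?k)"]) auto
qed

lemma mu_sum:
  assumes "\<And>k. F k \<in> sets (hausdorff_measure X.\<delta> C)" "disjoint_family F"
  shows "\<mu> (\<Union>k. F k) = (\<Sum>k\<in>UNIV. \<mu> (F (k::'m)))"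
proof -
  let ?M = "hausdorff_measure X.\<delta> C"
  have sub: "F k \<subseteq> C" for k using sets.sets_into_space[OF assms(1)] by (simp add: space_hausdorff_measure)
  have "(\<Sum>k\<in>UNIV. emeasure ?M (F k)) = emeasure ?M (\<Union>k. F k)"
    using assms by (intro sum_emeasure) auto
  then have "(\<Sum>k\<in>UNIV. ennreal (\<mu> (F k))) = ennreal (\<mu> (\<Union>k. F k))"
    using assms(1) sub by (simp add: emeasure_hausdorff_measure sets.finite_UN outer_eq UN_least)
  then show ?thesis by (simp add: mu_nonneg sum_nonneg)
qed

lemma mu_sum':
  assumes "\<And>k. F k \<in> sets (hausdorff_measure X.\<delta> C')" "disjoint_family F"
  shows "\<mu> (\<Union>k. F k) = (\<Sum>k\<in>UNIV. \<mu> (F (k::'m)))"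
proof -
  let ?M = "hausdorff_measure X.\<delta> C'"
  have sub: "F k \<subseteq> C'" for k using sets.sets_into_space[OF assms(1)] by (simp add: space_hausdorff_measure)
  have "(\<Sum>k\<in>UNIV. emeasure ?M (F k)) = emeasure ?M (\<Union>k. F k)"
    using assms by (intro sum_emeasure) auto
  then have "(\<Sum>k\<in>UNIV. ennreal (\<mu> (F k))) = ennreal (\<mu> (\<Union>k. F k))"
    using assms(1) sub by (simp add: emeasure_hausdorff_measure sets.finite_UN outer_eq' UN_least)
  then show ?thesis by (simp add: mu_nonneg sum_nonneg)
qed

text \<open>The density of a clone is the average of the densities of its children, weighted by
  their measures. If no child exceeds the average, all attain it.\<close>

lemma dens_children:
  assumes y: "y \<in> C" and le: "\<And>z. z \<in> X.clone n y \<Longrightarrow> dens (Suc n) z \<le> dens n y"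
  shows "dens (Suc n) y = dens n y"
proof -
  \<comment> \<open>The children are indexed by all symbols; a symbol that does not occur yields the
    empty set.\<close>
  define F where "F k = {z \<in> X.clone n y. X.\<kappa> ((X.T ^^ n) z) = k}" for k
  have F_clone: "F k = X.clone (Suc n) z" if "z \<in> F k" for k z
    using that X.clone_cong[of z n y] by (auto simp: F_def X.clone_Suc)
  have FC: "F k \<subseteq> C" for k using X.clone_le by (auto simp: F_def)
  have meas: "F k \<in> sets (hausdorff_measure X.\<delta> C)" "f ` F k \<in> sets (hausdorff_measure X.\<delta> C')" for k
    using F_clone[of _ k] X.clone_measurable[OF X.delta_nonneg] f_clone_measurable[OF X.delta_nonneg]
    by (cases "F k = {}"; force)+
  have disj: "disjoint_family F" by (auto simp: F_def disjoint_family_on_def)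
  have disj': "disjoint_family (\<lambda>k. f ` F k)"
    unfolding disjoint_family_on_def
  proof (intro ballI impI)
    fix k l assume "k \<noteq> (l::'m)"
    then have "F k \<inter> F l = {}" by (auto simp: F_def)
    then show "f ` F k \<inter> f ` F l = {}" using inj_on_image_Int[OF f_inj FC FC, of k l] by simp
  qed
  have U: "(\<Union>k. F k) = X.clone n y" by (auto simp: F_def)
  let ?s = "dens n y"
  have F_le: "\<mu> (f ` F k) \<le> ?s * \<mu> (F k)" for k
  proof (cases "F k = {}")
    case False
    then obtain z where z: "z \<in> F k" by blast
    then have "z \<in> X.clone n y" "z \<in> C" using FC by (auto simp: F_def)
    then show ?thesis using le[of z] mu_clone_pos[of z "Suc n"]
      unfolding F_clone[OF z] dens_def[of "Suc n"] by (simp add: divide_le_eq)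
  qed simp
  have "\<mu> (f ` X.clone n y) = (\<Sum>k\<in>UNIV. \<mu> (f ` F k))"
    using mu_sum'[OF meas(2) disj'] by (simp add: U image_UN[symmetric])
  moreover have "\<mu> (X.clone n y) = (\<Sum>k\<in>UNIV. \<mu> (F k))"
    using mu_sum[OF meas(1) disj] by (simp add: U)
  moreover have "\<mu> (f ` X.clone n y) = ?s * \<mu> (X.clone n y)"
    using mu_clone_pos[OF y, of n] by (simp add: dens_def)
  ultimately have "(\<Sum>k\<in>UNIV. ?s * \<mu> (F k) - \<mu> (f ` F k)) = 0"
    by (simp add: sum_subtractf sum_distrib_left)
  then have eq: "?s * \<mu> (F k) - \<mu> (f ` F k) = 0" for k
    using F_le by (subst (asm) sum_nonneg_eq_0_iff) auto
  let ?k = "X.\<kappa> ((X.T ^^ n) y)"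
  have "y \<in> F ?k" using X.clone_self[OF y] by (simp add: F_def)
  then show ?thesis using eq[of ?k] F_clone[of y ?k] mu_clone_pos[OF y, of "Suc n"]
    unfolding dens_def[of "Suc n"] by (simp add: divide_eq_eq)
qed

text \<open>
  Start at a clone whose density is so close to the supremum that no ratio in the finite set
  \<^const>\<open>ratios\<close> exceeding \<open>1\<close> fits in between: no child has larger density, hence by additivity
  every child has the same density, and so on.
\<close>

lemma constant_density:
  "\<exists>n. \<exists>x\<in>C. \<forall>l\<ge>n. \<forall>y\<in>X.clone n x. dens l y = dens n x"
proof -
  \<comment> \<open>The element 2 keeps the set non-empty in case no ratio exceeds 1.\<close>
  define Q where "Q = insert 2 {q\<in>ratios. 1 < q}"
  define \<theta> where "\<theta> = Min Q"
  have Q: "finite Q" "Q \<noteq> {}" using finite_ratios by (auto simp: Q_def)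
  have theta: "1 < \<theta>" unfolding \<theta>_def using Q by (subst Min_gr_iff) (auto simp: Q_def)
  have theta_le: "\<theta> \<le> q" if "q \<in> ratios" "1 < q" for q
    unfolding \<theta>_def using that Q by (intro Min_le) (auto simp: Q_def)
  define D where "D = (\<lambda>(n, x). dens n x) ` (UNIV \<times> C)"
  define S where "S = Sup D"
  have bdd: "bdd_above D" unfolding D_def using dens_le by (intro bdd_aboveI[of _ "K powr X.\<delta>"]) auto
  have le_S: "dens n x \<le> S" if "x \<in> C" for n x
    unfolding S_def using that by (intro cSup_upper bdd) (auto simp: D_def)
  obtain x0 where x0: "x0 \<in> C" using X.C_ne by blast
  have S: "0 < S" using dens_pos[OF x0, of 0] le_S[OF x0, of 0] by simp
  then have "S / \<theta> < S" using theta by (simp add: divide_less_eq)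
  moreover have "D \<noteq> {}" using x0 by (auto simp: D_def)
  ultimately obtain s where "s \<in> D" "S / \<theta> < s"
    using less_cSup_iff[of D "S / \<theta>"] bdd unfolding S_def by auto
  \<comment> \<open>A further increase by the factor \<open>\<theta>\<close> would overshoot the
    supremum.\<close>
  then obtain n x where x: "x \<in> C" and big: "S / \<theta> < dens n x" by (auto simp: D_def)
  have "dens (n + l) y = dens n x" if y: "y \<in> X.clone n x" for l y
    using y
  proof (induction l arbitrary: y)
    case 0
    then show ?case using X.clone_cong by (simp add: dens_def)
  next
    case (Suc l)
    have yC: "y \<in> C" using Suc.prems X.clone_le by blast
    have s: "dens (n + l) y = dens n x" by (rule Suc.IH[OF Suc.prems])
    have "dens (Suc (n + l)) y = dens (n + l) y"
    proof (rule dens_children[OF yC])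
      fix z assume z: "z \<in> X.clone (n + l) y"
      have zC: "z \<in> C" using z X.clone_le by blast
      let ?q = "dens (Suc (n + l)) z / dens (n + l) y"
      have pos: "0 < dens (n + l) y" by (rule dens_pos[OF yC])
      have "?q \<le> S / dens (n + l) y" using le_S[OF zC] pos by (intro divide_right_mono) auto
      also have "\<dots> < \<theta>" using big theta pos unfolding s by (simp add: field_simps)
      finally have "?q \<le> 1" using theta_le[OF dens_ratio[OF yC z]] by fastforce
      then show "dens (Suc (n + l)) z \<le> dens (n + l) y" using pos by simp
    qed
    then show ?case using s by simp
  qed
  then show ?thesis using x by (metis le_Suc_ex)
qed

end

section \<open>Measure linearity\<close>

locale constant_density_clone = bilipschitz_clopen_embedding C A E \<tau> r C' A' E' \<tau>' r' f K
  for C :: "'a::metric_space set" and A :: "'n::finite \<Rightarrow> 'a set" and E :: "'m::finite \<Rightarrow> 'a set"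
    and \<tau> r
    and C' :: "'b::metric_space set" and A' :: "'p::finite \<Rightarrow> 'b set" and E' :: "'q::finite \<Rightarrow> 'b set"
    and \<tau>' r' f K +
  fixes n :: nat and x :: 'a
  assumes x: "x \<in> C" and dens_eq: "n \<le> l \<Longrightarrow> y \<in> X.clone n x \<Longrightarrow> dens l y = dens n x"
begin

abbreviation B where "B \<equiv> X.clone n x"
abbreviation c where "c \<equiv> dens n x"
abbreviation H where "H \<equiv> hausdorff_outer X.\<delta>"
abbreviation M where "M \<equiv> hausdorff_measure X.\<delta> B"
abbreviation M' where "M' \<equiv> hausdorff_measure X.\<delta> C'"

lemma B_le: "B \<subseteq> C" by (rule X.clone_le)

lemma c_pos: "0 < c" by (rule dens_pos[OF x])

lemma inj_B: "inj_on f B" using f_inj B_le by (rule inj_on_subset)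

text \<open>The subclones of \<open>B\<close>, together with the empty set. Two clones are nested or
  disjoint, so this is a pi-system.\<close>

definition G :: "'a set set" where
  "G = insert {} (\<Union>l\<in>{n..}. X.clone l ` B)"

lemma G_cases:
  assumes "S \<in> G"
  obtains "S = {}" | l y where "n \<le> l" "y \<in> B" "S = X.clone l y"
  using assms by (auto simp: G_def)

lemma clone_le_B: "n \<le> l \<Longrightarrow> y \<in> B \<Longrightarrow> X.clone l y \<subseteq> B"
  using X.clone_antimono[of n l y] X.clone_cong[of y n x] by simp

lemma G_Pow: "G \<subseteq> Pow B"
  using clone_le_B by (auto elim!: G_cases)

lemma G_Int_stable: "Int_stable G"
proof (rule Int_stableI)
  fix S S' assume S: "S \<in> G" and S': "S' \<in> G"
  show "S \<inter> S' \<in> G"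
  proof (cases "S \<inter> S' = {}")
    case False
    then obtain l y l' y' where "S = X.clone l y" "S' = X.clone l' y'"
      using S S' by (auto elim!: G_cases)
    then have "S \<subseteq> S' \<or> S' \<subseteq> S"
      using X.clones_nested[of l l' y y'] X.clones_nested[of l' l y' y] False
      by (metis Int_commute nat_le_linear)
    then show ?thesis using S S' by (metis Int_absorb1 Int_absorb2)
  qed (simp add: G_def)
qed

text \<open>A Dynkin argument carrying measurability and scaling together: complements and disjoint
  unions need the measurability of the pieces on both sides.\<close>

lemma sigma_G_image:
  assumes "S \<in> sigma_sets B G"
  shows "S \<in> sets M \<and> f ` S \<in> sets M' \<and> H (f ` S) = ennreal c * H S"
  using G_Int_stable G_Pow assms
proof (induction rule: sigma_sets_induct_disjoint)
  case (basic S)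
  then show ?case
  proof (cases rule: G_cases)
    case (2 l y)
    have yC: "y \<in> C" using 2(2) B_le by blast
    have "S \<in> sets M"
      unfolding 2(3) using gap_subset[OF X.gap_clone clone_le_B[OF 2(1,2)] B_le] X.gap_clone_pos X.delta_nonneg
      by (rule gap_imp_measurable)
    moreover have "f ` S \<in> sets M'" unfolding 2(3) by (rule f_clone_measurable[OF X.delta_nonneg])
    moreover have "\<mu> (f ` S) = c * \<mu> S"
      using dens_eq[OF 2(1,2)] mu_clone_pos[OF yC, of l] unfolding dens_def[of l] 2(3)
      by (simp add: divide_eq_eq)
    moreover have "H (f ` S) = ennreal (\<mu> (f ` S))"
      unfolding 2(3) using X.clone_le f_in by (intro outer_eq') auto
    moreover have "H S = ennreal (\<mu> S)"
      unfolding 2(3) by (rule outer_eq[OF X.clone_le])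
    ultimately show ?thesis using c_pos by (simp add: ennreal_mult mu_nonneg)
  qed (simp add: hausdorff_outer_empty)
next
  case empty
  then show ?case by (simp add: hausdorff_outer_empty)
next
  case (compl S)
  have SB: "S \<subseteq> B" using sigma_sets_into_sp[OF G_Pow compl(1)] .
  have BM: "B \<in> sets M" using sets.top[of M] by (simp add: space_hausdorff_measure)
  have fB: "f ` B \<in> sets M'" by (rule f_clone_measurable[OF X.delta_nonneg])
  have im: "f ` (B - S) = f ` B - f ` S" using inj_B SB by (intro inj_on_image_set_diff) auto
  have fBC: "f ` B \<subseteq> C'" using B_le f_in by auto
  have 1: "H S + H (B - S) = H B"
    using hausdorff_outer_split[of S X.\<delta> B B] compl(2) SB by (simp add: Int_absorb1 Int_absorb2 Diff_Int_distrib2)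
  have 2: "H (f ` S) + H (f ` B - f ` S) = H (f ` B)"
  proof -
    have "f ` S \<inter> f ` B = f ` S" "(C' - f ` S) \<inter> f ` B = f ` B - f ` S" using SB fBC by blast+
    then show ?thesis using hausdorff_outer_split[of "f ` S" X.\<delta> C' "f ` B"] compl(2) fBC by simp
  qed
  have "\<mu> (f ` B) = c * \<mu> B" using mu_clone_pos[OF x, of n] by (simp add: dens_def)
  then have "H (f ` B) = ennreal c * H B"
    using outer_eq[OF B_le] outer_eq'[OF fBC] c_pos by (simp add: ennreal_mult mu_nonneg)
  then have "H (f ` S) + H (f ` B - f ` S) = H (f ` S) + ennreal c * H (B - S)"
    unfolding 2 1[symmetric] using compl(2) by (simp add: distrib_left)
  \<comment> \<open>Finiteness permits the cancellation that yields the complement.\<close>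
  moreover have "H (f ` S) < top" using SB fBC by (intro outer_finite') auto
  ultimately have "H (f ` B - f ` S) = ennreal c * H (B - S)"
    by (auto simp: ennreal_add_left_cancel)
  then show ?case using compl(2) BM fB im by (simp add: sets.Diff)
next
  case (union F)
  have FB: "F i \<subseteq> B" for i using union(2) sigma_sets_into_sp[OF G_Pow, of "F i"] by blast
  have im: "f ` (\<Union>i. F i) = (\<Union>i. f ` F i)" by blast
  have sets: "(\<Union>i. F i) \<in> sets M" "(\<Union>i. f ` F i) \<in> sets M'" using union(3) by auto
  have disj: "disjoint_family (\<lambda>i. f ` F i)"
    unfolding disjoint_family_on_def
  proof (intro ballI impI)
    fix i j :: nat assume "i \<noteq> j"
    then have "F i \<inter> F j = {}" using union(1) by (auto simp: disjoint_family_on_def)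
    then show "f ` F i \<inter> f ` F j = {}" using inj_on_image_Int[OF inj_B FB FB, of i j] by simp
  qed
  have "H (\<Union>i. f ` F i) = emeasure M' (\<Union>i. f ` F i)" using sets by (simp add: emeasure_hausdorff_measure)
  also have "\<dots> = (\<Sum>i. emeasure M' (f ` F i))" using union(3) disj by (intro suminf_emeasure[symmetric]) auto
  also have "\<dots> = (\<Sum>i. ennreal c * emeasure M (F i))"
    using union(3) by (simp add: emeasure_hausdorff_measure)
  also have "\<dots> = ennreal c * (\<Sum>i. emeasure M (F i))" by simp
  also have "(\<Sum>i. emeasure M (F i)) = emeasure M (\<Union>i. F i)"
    using union(1,3) by (intro suminf_emeasure) auto
  also have "\<dots> = H (\<Union>i. F i)" using sets by (simp add: emeasure_hausdorff_measure)
  finally show ?case using sets im by simp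
qed

text \<open>Each point of \<open>B\<close> outside \<open>F\<close> has a small clone around it
  missing \<open>F\<close>, and every level has only finitely many clones. So the complement is a
  countable union of generators.\<close>

lemma closed_sigma_G:
  assumes F: "closed F"
  shows "B \<inter> F \<in> sigma_sets B G"
proof -
  interpret S: sigma_algebra B "sigma_sets B G" using G_Pow by (rule sigma_algebra_sigma_sets)
  define U where "U l = {Q \<in> X.clone l ` B. Q \<inter> F = {}}" for l
  have "\<Union> (U l) \<in> sigma_sets B G" if "n \<le> l" for l
  proof (rule S.finite_Union)
    have "finite (X.clone l ` B)" by (rule finite_subset[OF image_mono[OF B_le] X.finite_clones])
    then show "finite (U l)" by (simp add: U_def)
    show "U l \<subseteq> sigma_sets B G" using that by (auto simp: U_def G_def intro!: sigma_sets.Basic)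
  qed
  then have "(\<Union>l. \<Union> (U (n + l))) \<in> sigma_sets B G" by (intro S.countable_UN) auto
  moreover have "(\<Union>l. \<Union> (U (n + l))) = B - F"
  proof (intro equalityI subsetI)
    fix y assume "y \<in> (\<Union>l. \<Union> (U (n + l)))"
    then obtain l z where z: "z \<in> B" "y \<in> X.clone (n + l) z" "X.clone (n + l) z \<inter> F = {}"
      by (auto simp: U_def)
    have "y \<in> B" using z(1,2) clone_le_B[of "n + l" z] by auto
    then show "y \<in> B - F" using z(2,3) by blast
  next
    fix y assume y: "y \<in> B - F"
    then have yC: "y \<in> C" using B_le by blast
    obtain e where e: "0 < e" "ball y e \<subseteq> - F"
      using F y by (metis ComplI DiffD2 openE open_Compl)
    obtain N where N: "\<And>l z. N \<le> l \<Longrightarrow> z \<in> X.clone l y \<Longrightarrow> dist y z < e"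
      using X.small_clone[OF yC e(1)] by blast
    have "z \<notin> F" if "z \<in> X.clone (n + N) y" for z
      using N[OF _ that] e(2) by (auto simp: subset_iff)
    then have "X.clone (n + N) y \<in> U (n + N)" using y by (auto simp: U_def)
    then show "y \<in> (\<Union>l. \<Union> (U (n + l)))" using X.clone_self[OF yC] by blast
  qed
  ultimately have "B - (B - F) \<in> sigma_sets B G" by (metis S.compl_sets)
  moreover have "B - (B - F) = B \<inter> F" by blast
  ultimately show ?thesis by simp
qed

lemma hull_sigma_G:
  assumes "\<And>i j. closed (F i j)"
  shows "B \<inter> (\<Inter>i::nat. \<Union>j::nat. F i j) \<in> sigma_sets B G"
proof -
  interpret S: sigma_algebra B "sigma_sets B G" using G_Pow by (rule sigma_algebra_sigma_sets)
  have "(\<Union>j. B \<inter> F i j) \<in> sigma_sets B G" for i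
    using closed_sigma_G[OF assms] by (intro S.countable_UN) blast
  then have "(\<Inter>i. \<Union>j. B \<inter> F i j) \<in> sigma_sets B G"
    by (intro S.countable_INT) blast+
  moreover have "(\<Inter>i. \<Union>j. B \<inter> F i j) = B \<inter> (\<Inter>i. \<Union>j. F i j)" by auto
  ultimately show ?thesis by simp
qed

text \<open>The upper bound replaces \<open>S\<close> by its closed hull, the lower bound replaces
  the image of \<open>S\<close> by its hull and pulls that back by the continuous \<open>f\<close>.
  Both hulls, cut down to \<open>B\<close>, lie where the scaling law is already known.\<close>

lemma outer_image:
  assumes S: "S \<subseteq> B"
  shows "H (f ` S) = ennreal c * H S"
proof (rule antisym)
  have fS: "f ` S \<subseteq> C'" using S B_le f_in by auto
  obtain F :: "nat \<Rightarrow> nat \<Rightarrow> 'a set" where F: "\<And>i j. closed (F i j)" "S \<subseteq> (\<Inter>i. \<Union>j. F i j)"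
    "H (\<Inter>i. \<Union>j. F i j) \<le> H S"
    by (rule hausdorff_outer_closed_hull[OF outer_finite[OF order_trans[OF S B_le]] X.delta_nonneg]) (rule that)
  let ?D = "B \<inter> (\<Inter>i. \<Union>j. F i j)"
  have "H (f ` S) \<le> H (f ` ?D)" using S F(2) by (intro hausdorff_outer_mono image_mono) auto
  also have "\<dots> = ennreal c * H ?D" using sigma_G_image[OF hull_sigma_G[of F, OF F(1)]] by blast
  also have "\<dots> \<le> ennreal c * H S"
    using order_trans[OF hausdorff_outer_mono[OF Int_lower2] F(3)] by (rule mult_left_mono) simp
  finally show "H (f ` S) \<le> ennreal c * H S" .
  obtain F' :: "nat \<Rightarrow> nat \<Rightarrow> 'b set" where F': "\<And>i j. closed (F' i j)" "f ` S \<subseteq> (\<Inter>i. \<Union>j. F' i j)"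
    "H (\<Inter>i. \<Union>j. F' i j) \<le> H (f ` S)"
    by (rule hausdorff_outer_closed_hull[OF outer_finite'[OF fS] X.delta_nonneg]) (rule that)
  have "continuous_on B f"
  proof (rule continuous_on_subset[OF _ B_le])
    show "continuous_on C f"
      using f_le K_pos by (intro lipschitz_on_continuous_on[of K] lipschitz_onI) auto
  qed
  moreover have "closed B"
  proof -
    have "closedin (top_of_set C) B" using gap_imp_clopen_in[OF X.gap_clone X.gap_clone_pos] by (simp add: clopen_in_def)
    then show ?thesis using compact_imp_closed[OF X.compact] by (rule closedin_closed_trans)
  qed
  ultimately have cl: "closed (B \<inter> f -` F' i j)" for i j
    using F'(1) by (intro continuous_closed_preimage)
  let ?D' = "B \<inter> (\<Inter>i. \<Union>j. B \<inter> f -` F' i j)"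
  have "ennreal c * H S \<le> ennreal c * H ?D'"
    using S F'(2) by (intro mult_left_mono hausdorff_outer_mono) (auto simp: subset_iff)
  also have "\<dots> = H (f ` ?D')" using sigma_G_image[OF hull_sigma_G[of "\<lambda>i j. B \<inter> f -` F' i j", OF cl]] by simp
  also have "\<dots> \<le> H (\<Inter>i. \<Union>j. F' i j)" by (intro hausdorff_outer_mono) auto
  finally show "ennreal c * H S \<le> H (f ` S)" using F'(3) by simp
qed

text \<open>Because the outer measure of every subset of \<open>B\<close> scales by the same factor,
  Caratheodory's splitting criterion for \<open>S\<close> in \<open>B\<close> carries over to its
  image.\<close>

lemma measurable_image:
  assumes S: "S \<in> sets M"
  shows "f ` S \<in> sets M'"
proof -
  have SB: "S \<subseteq> B" using sets.sets_into_space[OF S] by (simp add: space_hausdorff_measure)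
  have fBC: "f ` B \<subseteq> C'" using B_le f_in by auto
  have fB: "f ` B \<in> sets M'" by (rule f_clone_measurable[OF X.delta_nonneg])
  have "H (f ` S \<inter> Y) + H ((C' - f ` S) \<inter> Y) = H Y" if Y: "Y \<subseteq> C'" for Y
  proof -
    \<comment> \<open>The part of the test set inside the image of \<open>B\<close> is pulled back
      and split there; the rest is cut off by the measurable image of \<open>B\<close>.\<close>
    let ?Y = "B \<inter> f -` Y"
    have e1: "f ` S \<inter> Y = f ` (S \<inter> ?Y)" using SB by blast
    have e2: "f ` B \<inter> ((C' - f ` S) \<inter> Y) = f ` ((B - S) \<inter> ?Y)"
      using inj_on_image_set_diff[OF inj_B, of B S] SB fBC by blast
    have e3: "(C' - f ` B) \<inter> ((C' - f ` S) \<inter> Y) = (C' - f ` B) \<inter> Y" using SB by blast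
    have e4: "f ` B \<inter> Y = f ` ?Y" by blast
    have "H ((C' - f ` S) \<inter> Y) = H (f ` ((B - S) \<inter> ?Y)) + H ((C' - f ` B) \<inter> Y)"
    proof -
      have "(C' - f ` S) \<inter> Y \<subseteq> C'" by blast
      from hausdorff_outer_split[OF fB this, unfolded e2 e3] show ?thesis by (rule sym)
    qed
    also have "H (f ` ((B - S) \<inter> ?Y)) = ennreal c * H ((B - S) \<inter> ?Y)" by (intro outer_image) auto
    finally have "H (f ` S \<inter> Y) + H ((C' - f ` S) \<inter> Y)
        = ennreal c * (H (S \<inter> ?Y) + H ((B - S) \<inter> ?Y)) + H ((C' - f ` B) \<inter> Y)"
      unfolding e1 using SB by (subst outer_image) (auto simp: distrib_left add.assoc)
    also have "H (S \<inter> ?Y) + H ((B - S) \<inter> ?Y) = H ?Y" by (rule hausdorff_outer_split[OF S]) simp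
    also have "ennreal c * H ?Y = H (f ` B \<inter> Y)" unfolding e4 by (rule outer_image[symmetric]) simp
    also have "H (f ` B \<inter> Y) + H ((C' - f ` B) \<inter> Y) = H Y" by (rule hausdorff_outer_split[OF fB Y])
    finally show ?thesis .
  qed
  then show ?thesis using SB fBC by (auto simp: sets_hausdorff_measure lambda_system_def)
qed

lemma measure_linear_B: "measure_linear M M' f"
  unfolding measure_linear_def
proof (intro exI conjI ballI)
  show "0 \<le> c" using c_pos by simp
  fix S assume S: "S \<in> sets M"
  then have SB: "S \<subseteq> B" using sets.sets_into_space by (fastforce simp: space_hausdorff_measure)
  show "f ` S \<in> sets M'" by (rule measurable_image[OF S])
  then show "emeasure M' (f ` S) = ennreal c * emeasure M S"
    using S outer_image[OF SB] by (simp add: emeasure_hausdorff_measure)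
qed

end

theorem theorem2:
  fixes C :: "'a::metric_space set"
    and A :: "'n::finite \<Rightarrow> 'a set"
    and E :: "'m::finite \<Rightarrow> 'a set"
    and \<tau> :: "'m \<Rightarrow> 'a \<Rightarrow> 'a"
    and r :: "'m \<Rightarrow> real"
    and C' :: "'b::metric_space set"
    and A' :: "'p::finite \<Rightarrow> 'b set"
    and E' :: "'q::finite \<Rightarrow> 'b set"
    and \<tau>' :: "'q \<Rightarrow> 'b \<Rightarrow> 'b"
    and r' :: "'q \<Rightarrow> real"
    and f :: "'a \<Rightarrow> 'b"
    and K :: real
  assumes "multi_model_cantor_set C A E \<tau> r"
    and "has_irreducible_matrix A E \<tau> r"
    and "multi_model_cantor_set C' A' E' \<tau>' r'"
    and "has_irreducible_matrix A' E' \<tau>' r'"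
    and "bilipschitz_on K C f"
    and "clopen_in C' (f ` C)"
  shows "\<exists>\<delta>::real. 0 \<le> \<delta> \<and> hausdorff_dim C = ennreal \<delta> \<and> hausdorff_dim C' = ennreal \<delta> \<and>
           (\<exists>B. B \<noteq> {} \<and> clopen_in C B \<and>
                measure_linear (hausdorff_measure \<delta> B) (hausdorff_measure \<delta> C') f)"
proof -
  interpret bilipschitz_clopen_embedding C A E \<tau> r C' A' E' \<tau>' r' f K
    using assms
    by (simp add: bilipschitz_clopen_embedding_def bilipschitz_clopen_embedding_axioms_def
        irreducible_cantor_set_def irreducible_cantor_set_axioms_def)
  obtain n x where x: "x \<in> C" and dens: "\<forall>l\<ge>n. \<forall>y\<in>X.clone n x. dens l y = dens n x"
    using constant_density by blast
  interpret constant_density_clone C A E \<tau> r C' A' E' \<tau>' r' f K n x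
    using bilipschitz_clopen_embedding_axioms x dens
    by (simp add: constant_density_clone_def constant_density_clone_axioms_def)
  show ?thesis
  proof (intro exI conjI)
    show "0 \<le> X.\<delta>" by (rule X.delta_nonneg)
    show "hausdorff_dim C = ennreal X.\<delta>" by (rule X.hausdorff_dim_eq)
    show "hausdorff_dim C' = ennreal X.\<delta>" using Y.hausdorff_dim_eq by (simp add: same_exponent)
    show "X.clone n x \<noteq> {}" using X.clone_self[OF x] by blast
    show "clopen_in C (X.clone n x)" by (rule gap_imp_clopen_in[OF X.gap_clone X.gap_clone_pos])
    show "measure_linear (hausdorff_measure X.\<delta> (X.clone n x)) (hausdorff_measure X.\<delta> C') f"
      by (rule measure_linear_B)
  qed
qed

end
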